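(* For every real $r>0$, $$\beta_r=\frac12-\frac{1-20\alpha_{3r}-8\alpha_{3r}^2}{2(1+8\alpha_{3r})^{3/2}}.$$
   Context: ${}_2F_1(a,b;c;w)=\sum_{n\ge 0}\frac{(a)_n(b)_n}{(c)_n}\frac{w^n}{n!}$ for $|w|<1$, where $(a)_n=a(a+1)\cdots(a+n-1)$, $(a)_0=1$. For real $r>0$, $\beta_r\in(0,1)$ is the solution of $\frac{{}_2F_1(\frac16,\frac56;1;1-\beta_r)}{{}_2F_1(\frac16,\frac56;1;\beta_r)}=\sqrt r$. The cubic theta functions are, for $0<q<1$, $$a(q)=\sum_{m,n=-\infty}^{\infty}q^{m^2+mn+n^2},\qquad c(q)=\sum_{m,n=-\infty}^{\infty}q^{(m+1/3)^2+(m+1/3)(n+1/3)+(n+1/3)^2}.$$ For real $r>0$, with $q=e^{-\pi\sqrt r}$, the cubic singular modulus is $\alpha_r=\left(\frac{c(q^{2/\sqrt3})}{a(q^{2/\sqrt3})}\right)^3\in(0,1)$; it satisfies $\frac{{}_2F_1(\frac13,\frac23;1;1-\alpha_r)}{{}_2F_1(\frac13,\frac23;1;\alpha_r)}=\sqrt r$. In the claim, $\alpha_{3r}$ is this function evaluated at $3r$. *)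

theory Defs
  imports "HOL-Analysis.Analysis"
begin

text \<open>The Gaussian hypergeometric series; only meaningful for \<open>\<bar>w\<bar> < 1\<close>.\<close>
definition hyp2F1 :: "real \<Rightarrow> real \<Rightarrow> real \<Rightarrow> real \<Rightarrow> real" where
  "hyp2F1 a b c w = (\<Sum>n. pochhammer a n * pochhammer b n / pochhammer c n * (w ^ n / fact n))"

definition beta_mod :: "real \<Rightarrow> real" where
  "beta_mod r = (THE \<beta>. 0 < \<beta> \<and> \<beta> < 1 \<and>
     hyp2F1 (1/6) (5/6) 1 (1 - \<beta>) / hyp2F1 (1/6) (5/6) 1 \<beta> = sqrt r)"

text \<open>The double series converge absolutely for \<open>0 < q < 1\<close>, so the summation over
  \<open>\<int> \<times> \<int>\<close> is rendered as an unordered sum.\<close>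
definition cubic_theta_a :: "real \<Rightarrow> real" where
  "cubic_theta_a q = (\<Sum>\<^sub>\<infinity>(m, n)\<in>(UNIV :: (int \<times> int) set).
     q powr (of_int m ^ 2 + of_int m * of_int n + of_int n ^ 2))"

definition cubic_theta_c :: "real \<Rightarrow> real" where
  "cubic_theta_c q = (\<Sum>\<^sub>\<infinity>(m, n)\<in>(UNIV :: (int \<times> int) set).
     q powr ((of_int m + 1/3) ^ 2 + (of_int m + 1/3) * (of_int n + 1/3) + (of_int n + 1/3) ^ 2))"

definition cubic_singular_modulus :: "real \<Rightarrow> real" where
  "cubic_singular_modulus r =
     (let q = exp (- pi * sqrt r)
      in (cubic_theta_c (q powr (2 / sqrt 3)) / cubic_theta_a (q powr (2 / sqrt 3))) ^ 3)"

end

theory Submission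
  imports Defs
begin

text \<open>Write \<open>F\<^sub>a\<close> for the hypergeometric function with parameters \<open>a, 1 - a; 1\<close> and \<open>x(q) = (c(q)/a(q))\<^sup>3\<close>.
  Comparing differential equations at a singular point gives the algebraic relations
  \<open>F\<^sub>1\<^sub>/\<^sub>6(\<beta>) = (1 + 8 x)\<^sup>1\<^sup>/\<^sup>4 F\<^sub>1\<^sub>/\<^sub>3(x)\<close> and \<open>\<surd>3 F\<^sub>1\<^sub>/\<^sub>6(1 - \<beta>) = (1 + 8 x)\<^sup>1\<^sup>/\<^sup>4 F\<^sub>1\<^sub>/\<^sub>3(1 - x)\<close>, where \<open>\<beta>\<close> is the
  right-hand side of the theorem, so it remains to compute
  \<open>h(q) = F\<^sub>1\<^sub>/\<^sub>3(1 - x(q)) / F\<^sub>1\<^sub>/\<^sub>3(x(q))\<close>. Modular transformations are not needed for this: counting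
  Eisenstein integers expresses \<open>a(q)\<close> and \<open>c(q)\<^sup>3\<close> by \<open>a(q\<^sup>3)\<close> and \<open>c(q\<^sup>3)\<close>, and with the cubic
  transformation of \<open>F\<^sub>1\<^sub>/\<^sub>3\<close> this yields \<open>h(q\<^sup>3) = 3 h(q)\<close>. Since \<open>x(q)\<close> has the order of \<open>q\<close> and
  \<open>F\<^sub>1\<^sub>/\<^sub>3(1 - x) \<sim> - (\<surd>3 / 2\<pi>) ln x\<close> as \<open>x \<rightarrow> 0\<close>, iterating gives \<open>h(q) = - (\<surd>3 / 2\<pi>) ln q\<close>.\<close>

section \<open>The hypergeometric function with parameters \<open>a, 1 - a; 1\<close>\<close>

definition hg_coeff :: "real \<Rightarrow> nat \<Rightarrow> real" where
  "hg_coeff a n = pochhammer a n * pochhammer (1 - a) n / (fact n)\<^sup>2"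

definition hgF :: "real \<Rightarrow> real \<Rightarrow> real" where
  "hgF a t = (\<Sum>n. hg_coeff a n * t ^ n)"

text \<open>The hypergeometric equation is used as the first-order system
  \<open>t (1 - t) F' = G\<close>, \<open>G' = a (1 - a) F\<close>.\<close>
definition hgG :: "real \<Rightarrow> real \<Rightarrow> real" where
  "hgG a t = t * (1 - t) * (\<Sum>n. diffs (hg_coeff a) n * t ^ n)"

lemma hyp2F1_eq_hgF: "hyp2F1 a (1 - a) 1 t = hgF a t"
  by (simp add: hyp2F1_def hgF_def hg_coeff_def pochhammer_fact[symmetric] power2_eq_square)

lemma hg_coeff_0 [simp]: "hg_coeff a 0 = 1"
  by (simp add: hg_coeff_def)

lemma hg_coeff_Suc: "(real n + 1)\<^sup>2 * hg_coeff a (Suc n) = (a + n) * (1 - a + n) * hg_coeff a n"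
proof -
  have "hg_coeff a (Suc n) = (a + n) * (1 - a + n) * hg_coeff a n / (real n + 1)\<^sup>2"
    by (simp add: hg_coeff_def pochhammer_Suc power2_eq_square algebra_simps)
  then show ?thesis by (simp add: field_simps)
qed

lemma hg_coeff_pos:
  assumes "0 < a" "a < 1" shows "0 < hg_coeff a n"
  using assms by (simp add: hg_coeff_def pochhammer_pos)

lemma hg_coeff_le_1:
  assumes "0 < a" "a < 1" shows "hg_coeff a n \<le> 1"
proof -
  have "pochhammer a n \<le> fact n" "pochhammer (1 - a) n \<le> fact n"
    unfolding pochhammer_fact pochhammer_prod using assms by (auto intro!: prod_mono)
  then have "pochhammer a n * pochhammer (1 - a) n \<le> fact n * fact n"
    using assms by (intro mult_mono) (auto intro!: pochhammer_nonneg)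
  then show ?thesis
    by (simp add: hg_coeff_def power2_eq_square divide_le_eq)
qed

lemma summable_hg:
  assumes "0 < a" "a < 1" "\<bar>t\<bar> < 1" shows "summable (\<lambda>n. hg_coeff a n * t ^ n)"
proof (rule summable_comparison_test')
  show "summable (\<lambda>n. \<bar>t\<bar> ^ n)" using assms by (intro summable_geometric) auto
  show "norm (hg_coeff a n * t ^ n) \<le> \<bar>t\<bar> ^ n" for n
    using hg_coeff_pos[OF assms(1,2), of n] hg_coeff_le_1[OF assms(1,2), of n]
    by (simp add: abs_mult power_abs mult_left_le_one_le)
qed

lemma hgF_deriv0:
  assumes "0 < a" "a < 1" "\<bar>t\<bar> < 1"
  shows "(hgF a has_real_derivative (\<Sum>n. diffs (hg_coeff a) n * t ^ n)) (at t)"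
  unfolding hgF_def[abs_def]
  by (rule termdiffs_strong'[where K = 1]) (use assms summable_hg in auto)

lemma hgF_deriv:
  assumes "0 < a" "a < 1" "0 < t" "t < 1"
  shows "(hgF a has_real_derivative hgG a t / (t * (1 - t))) (at t)"
  using hgF_deriv0[of a t] assms by (simp add: hgG_def)

lemma summable_hg_diffs:
  assumes "0 < a" "a < 1" "\<bar>t\<bar> < 1" shows "summable (\<lambda>n. diffs (hg_coeff a) n * t ^ n)"
  by (rule termdiff_converges[where K = 1]) (use assms summable_hg in auto)

lemma hgG_deriv:
  assumes a: "0 < a" "a < 1" and t: "\<bar>t\<bar> < 1"
  shows "(hgG a has_real_derivative a * (1 - a) * hgF a t) (at t)"
proof -
  \<comment> \<open>\<open>e\<close> lists the coefficients of the primitive of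
    \<open>a * (1 - a) * hgF a\<close> vanishing at 0. By \<open>hg_coeff_Suc\<close> they are also
    those of \<open>x * (1 - x)\<close> times the derivative of \<open>hgF a\<close>, so one
    termwise differentiation gives the hypergeometric equation, including at 0.\<close>
  define e :: "nat \<Rightarrow> real" where
    "e n = (case n of 0 \<Rightarrow> 0 | Suc m \<Rightarrow> a * (1 - a) * hg_coeff a m / (real m + 1))" for n
  have e: "e (Suc n) = diffs (hg_coeff a) n - real n * hg_coeff a n" for n
  proof -
    have "(real n + 1) * e (Suc n) = a * (1 - a) * hg_coeff a n"
      by (simp add: e_def)
    also have "\<dots> = (real n + 1) * (diffs (hg_coeff a) n - real n * hg_coeff a n)"
      using hg_coeff_Suc[of n a] by (simp add: diffs_def algebra_simps power2_eq_square)
    finally show ?thesis by (simp add: add_nonneg_pos)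
  qed
  have sums: "(\<lambda>n. e n * x ^ n) sums hgG a x" if x: "\<bar>x\<bar> < 1" for x
  proof -
    let ?d = "diffs (hg_coeff a)"
    have 1: "(\<lambda>n. ?d n * x ^ n) sums (\<Sum>n. ?d n * x ^ n)"
      using summable_hg_diffs[OF a x] by (rule summable_sums)
    have "(\<lambda>n. real (Suc n) * hg_coeff a (Suc n) * x ^ (Suc n)) sums ((\<Sum>n. ?d n * x ^ n) * x)"
      using sums_mult2[OF 1, of x] by (simp add: diffs_def mult_ac)
    then have 2: "(\<lambda>n. real n * hg_coeff a n * x ^ n) sums ((\<Sum>n. ?d n * x ^ n) * x)"
      by (subst (asm) sums_Suc_iff) simp
    have "(\<lambda>n. x * (?d n * x ^ n - real n * hg_coeff a n * x ^ n)) sums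
        (x * ((\<Sum>n. ?d n * x ^ n) - (\<Sum>n. ?d n * x ^ n) * x))"
      by (intro sums_mult sums_diff 1 2)
    then have "(\<lambda>n. e (Suc n) * x ^ Suc n) sums hgG a x"
      by (simp add: e hgG_def algebra_simps)
    then show ?thesis by (subst (asm) sums_Suc_iff) (simp add: e_def)
  qed
  have "((\<lambda>x. \<Sum>n. e n * x ^ n) has_real_derivative (\<Sum>n. diffs e n * t ^ n)) (at t)"
    by (rule termdiffs_strong'[where K = 1]) (use t sums in \<open>auto simp: sums_iff\<close>)
  moreover have "diffs e n = a * (1 - a) * hg_coeff a n" for n
  proof -
    have "1 + real n \<noteq> 0" by linarith
    then show ?thesis by (simp add: diffs_def e_def add.commute)
  qed
  then have "(\<Sum>n. diffs e n * t ^ n) = a * (1 - a) * hgF a t"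
    using suminf_mult[OF summable_hg[OF a t], of "a * (1 - a)"]
    by (simp add: hgF_def mult.assoc)
  ultimately have D: "((\<lambda>x. \<Sum>n. e n * x ^ n) has_real_derivative a * (1 - a) * hgF a t) (at t)"
    by simp
  have "(\<Sum>n. e n * x ^ n) = hgG a x" if "x \<in> {-1<..<1}" for x
    using sums[of x] that by (simp add: sums_iff abs_less_iff)
  then show ?thesis
    using has_field_derivative_transform_within_open[OF D, of "{-1<..<1}" "hgG a"] t
    by (simp add: abs_less_iff)
qed

lemma isCont_hgF:
  assumes "0 < a" "a < 1" "isCont f x" "\<bar>f x\<bar> < 1" shows "isCont (\<lambda>x. hgF a (f x)) x"
  using isCont_o2[OF assms(3) DERIV_isCont[OF hgF_deriv0[OF assms(1,2,4)]]] .

lemma isCont_hgG: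
  assumes "0 < a" "a < 1" "isCont f x" "\<bar>f x\<bar> < 1" shows "isCont (\<lambda>x. hgG a (f x)) x"
  using isCont_o2[OF assms(3) DERIV_isCont[OF hgG_deriv[OF assms(1,2,4)]]] .

lemma hgF_0 [simp]: "hgF a 0 = 1"
  by (simp add: hgF_def powser_zero)

lemma hgG_0 [simp]: "hgG a 0 = 0"
  by (simp add: hgG_def)

lemma hgF_strict_mono:
  assumes a: "0 < a" "a < 1" and t: "0 \<le> s" "s < t" "t < 1"
  shows "hgF a s < hgF a t"
proof -
  have summ: "summable (\<lambda>n. hg_coeff a n * t ^ n)" "summable (\<lambda>n. hg_coeff a n * s ^ n)"
    using summable_hg[OF a] t by auto
  have "0 < (\<Sum>n. hg_coeff a n * t ^ n - hg_coeff a n * s ^ n)"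
  proof (rule suminf_pos2[where i = 1])
    show "0 \<le> hg_coeff a n * t ^ n - hg_coeff a n * s ^ n" for n
      using hg_coeff_pos[OF a, of n] t by (auto intro!: mult_left_mono power_mono)
    show "0 < hg_coeff a 1 * t ^ 1 - hg_coeff a 1 * s ^ 1"
      using hg_coeff_pos[OF a, of 1] t by simp
  qed (intro summable_diff summ)
  then show ?thesis using suminf_diff[OF summ] by (simp add: hgF_def)
qed

lemma hgF_ge_1:
  assumes "0 < a" "a < 1" "0 \<le> t" "t < 1" shows "1 \<le> hgF a t"
  using hgF_strict_mono[of a 0 t] assms by (cases "t = 0") auto

text \<open>The ratio is strictly decreasing, since \<open>hgF a\<close> increases in its argument.
  This gives the uniqueness behind the description operator in \<open>beta_mod\<close>.\<close>

lemma hgF_ratio_inj: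
  assumes a: "0 < a" "a < 1" and x: "0 < x" "x < 1" and y: "0 < y" "y < 1"
    and eq: "hgF a (1 - x) / hgF a x = hgF a (1 - y) / hgF a y"
  shows "x = y"
proof -
  have *: "hgF a (1 - v) / hgF a v < hgF a (1 - u) / hgF a u"
    if "0 < u" "u < v" "v < 1" for u v
  proof (rule frac_less)
    show "hgF a (1 - v) < hgF a (1 - u)" using that a by (intro hgF_strict_mono) auto
    show "hgF a u \<le> hgF a v" using hgF_strict_mono[of a u v] that a by auto
    show "0 \<le> hgF a (1 - v)" using hgF_ge_1[of a "1 - v"] that a by auto
    show "0 < hgF a u" using hgF_ge_1[of a u] that a by auto
  qed
  show ?thesis using *[of x y] *[of y x] x y eq by (cases x y rule: linorder_cases) auto
qed

text \<open>Two solutions of \<open>(P Y')' = Q Y\<close> have a constant Wronskian \<open>Y\<^sub>1 Z\<^sub>2 - Y\<^sub>2 Z\<^sub>1\<close>, \<open>Z\<^sub>i = P Y\<^sub>i'\<close>.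
  If it vanishes at an endpoint \<open>e\<close>, then \<open>Y\<^sub>2 / Y\<^sub>1\<close> is constant.\<close>
lemma solutions_proportional:
  fixes Y1 Y2 Z1 Z2 P Q :: "real \<Rightarrow> real"
  assumes e: "e = l \<or> e = u" and x: "l < x" "x < u"
    and Y1: "\<And>x. l < x \<Longrightarrow> x < u \<Longrightarrow> (Y1 has_real_derivative Z1 x / P x) (at x)"
    and Y2: "\<And>x. l < x \<Longrightarrow> x < u \<Longrightarrow> (Y2 has_real_derivative Z2 x / P x) (at x)"
    and Z1: "\<And>x. l < x \<Longrightarrow> x < u \<Longrightarrow> (Z1 has_real_derivative Q x * Y1 x) (at x)"
    and Z2: "\<And>x. l < x \<Longrightarrow> x < u \<Longrightarrow> (Z2 has_real_derivative Q x * Y2 x) (at x)"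
    and cont: "isCont Y1 e" "isCont Y2 e" "isCont Z1 e" "isCont Z2 e"
    and zero: "Z1 e = 0" "Z2 e = 0"
    and nz: "\<And>x. l < x \<Longrightarrow> x < u \<Longrightarrow> Y1 x \<noteq> 0" "Y1 e \<noteq> 0"
    and P: "\<And>x. l < x \<Longrightarrow> x < u \<Longrightarrow> P x \<noteq> 0"
  shows "Y2 x * Y1 e = Y2 e * Y1 x"
proof -
  \<comment> \<open>In the applications \<open>P\<close> vanishes at \<open>e\<close>, so the
    equation is singular there; constancy reaches the endpoint through continuity alone.\<close>
  have const: "f x = f e"
    if D: "\<And>x. l < x \<Longrightarrow> x < u \<Longrightarrow> (f has_real_derivative 0) (at x)" and C: "isCont f e"
      and x: "l < x" "x < u" for f :: "real \<Rightarrow> real" and x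
  proof -
    have cont: "isCont f y" if "l < y \<and> y < u \<or> y = e" for y
      using D[of y] C that by (auto intro: DERIV_isCont)
    from e show ?thesis
    proof
      assume "e = l"
      then have "continuous_on {l..x} f"
        using x by (intro continuous_at_imp_continuous_on ballI cont) auto
      then show ?thesis using DERIV_isconst_end[of l x f] D x \<open>e = l\<close> by auto
    next
      assume "e = u"
      then have "continuous_on {x..u} f"
        using x by (intro continuous_at_imp_continuous_on ballI cont) auto
      then show ?thesis using DERIV_isconst_end[of x u f] D x \<open>e = u\<close> by auto
    qed
  qed
  define W where "W x = Y1 x * Z2 x - Y2 x * Z1 x" for x
  have W: "W x = 0" if "l < x" "x < u" for x
  proof -
    have "W x = W e"
    proof (rule const[OF _ _ that])
      show "isCont W e" unfolding W_def by (intro continuous_intros cont)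
      show "(W has_real_derivative 0) (at x)" if "l < x" "x < u" for x
        unfolding W_def
        by (rule derivative_eq_intros Y1 Y2 Z1 Z2 that refl)+ (simp add: algebra_simps)
    qed
    then show ?thesis by (simp add: W_def zero)
  qed
  have "Y2 x / Y1 x = Y2 e / Y1 e"
  proof (rule const[OF _ _ x])
    show "isCont (\<lambda>x. Y2 x / Y1 x) e" by (intro continuous_intros cont nz)
    fix x assume x: "l < x" "x < u"
    have "Z2 x / P x * Y1 x - Y2 x * (Z1 x / P x) = W x / P x"
      by (simp add: W_def diff_divide_distrib mult.commute)
    also have "\<dots> = 0" using W[OF x] by simp
    finally show "((\<lambda>x. Y2 x / Y1 x) has_real_derivative 0) (at x)"
      by (rule_tac derivative_eq_intros Y1 Y2 x nz refl)+ simp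
  qed
  then show ?thesis using nz x by (simp add: field_simps)
qed

section \<open>Algebraic transformations\<close>

text \<open>After division by \<open>1 + 2 * x\<close> both sides solve
  \<open>(P Y')' = 2 x^2 Y\<close> with \<open>P = x (1 - x^3)\<close>. At \<open>x = 1\<close> both
  hypergeometric arguments are 0 and both solutions are regular with value 1, so
  \<open>solutions_proportional\<close> applies at that endpoint.\<close>

lemma hgF_cubic_transformation:
  fixes x :: real
  assumes x: "0 < x" "x < 1"
  shows "3 * hgF (1/3) (((1 - x) / (1 + 2 * x)) ^ 3) = (1 + 2 * x) * hgF (1/3) (1 - x ^ 3)"
proof -
  define F where "F = hgF (1/3)"
  define G where "G = hgG (1/3)"
  define y :: "real \<Rightarrow> real" where "y x = (1 - x) / (1 + 2 * x)" for x
  define P :: "real \<Rightarrow> real" where "P x = x * (1 - x ^ 3)" for x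
  have F': "(F has_real_derivative G t / (t * (1 - t))) (at t)" if "0 < t" "t < 1" for t
    unfolding F_def G_def by (rule hgF_deriv) (use that in auto)
  have G': "(G has_real_derivative (2/9) * F t) (at t)" if "0 < t" "t < 1" for t
    unfolding F_def G_def using hgG_deriv[of "1/3" t] that by simp
  have y01: "0 < y x" "y x < 1" if "0 < x" "x < 1" for x
    using that by (auto simp: y_def field_simps)
  have y': "(y has_real_derivative - 3 / (1 + 2 * x)\<^sup>2) (at x)" if "0 < x" "x < 1" for x
    unfolding y_def
    by (rule derivative_eq_intros refl)+ (use that in \<open>auto simp: divide_simps power2_eq_square algebra_simps\<close>)
  have y3: "((\<lambda>x. y x ^ 3) has_real_derivative - 9 * (y x)\<^sup>2 / (1 + 2 * x)\<^sup>2) (at x)"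
    if "0 < x" "x < 1" for x
    by (rule derivative_eq_intros y' that refl)+ (simp add: power2_eq_square)
  have one_y3: "1 - y x ^ 3 = 9 * x * (1 + x + x\<^sup>2) / (1 + 2 * x) ^ 3" if "0 < x" "x < 1" for x
    using that by (simp add: y_def divide_simps) (simp add: algebra_simps power2_eq_square power3_eq_cube)
  have "3 / (1 + 2 * x) * F (y x ^ 3) * F (1 - 1 ^ 3) =
      3 / (1 + 2 * 1) * F (y 1 ^ 3) * F (1 - x ^ 3)"
  proof (rule solutions_proportional[where l = 0 and u = 1 and P = P and Q = "\<lambda>x. 2 * x\<^sup>2" and
        ?Y1.0 = "\<lambda>x. F (1 - x ^ 3)" and ?Z1.0 = "\<lambda>x. - 3 * G (1 - x ^ 3)" and
        ?Z2.0 = "\<lambda>x. - 6 * P x / (1 + 2 * x)\<^sup>2 * F (y x ^ 3) - 3 * (1 + 2 * x) * G (y x ^ 3)"])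
    fix x :: real assume x: "0 < x" "x < 1"
    have x3: "0 < x ^ 3" "x ^ 3 < 1"
      using x by (auto simp: power_less_one_iff)
    have y3_01: "0 < y x ^ 3" "y x ^ 3 < 1"
      using y01[OF x] by (auto simp: power_less_one_iff)
    show P: "P x \<noteq> 0" using x x3 by (simp add: P_def)
    show "F (1 - x ^ 3) \<noteq> 0"
      using hgF_ge_1[of "1/3" "1 - x ^ 3"] x3 by (auto simp: F_def)
    have u': "((\<lambda>x. 1 - x ^ 3) has_real_derivative - 3 * x\<^sup>2) (at x)"
      by (rule derivative_eq_intros refl)+ simp
    show "((\<lambda>x. F (1 - x ^ 3)) has_real_derivative - 3 * G (1 - x ^ 3) / P x) (at x)"
      by (rule DERIV_cong[OF DERIV_chain2[OF F' u']])
         (use x x3 in \<open>auto simp: P_def divide_simps power2_eq_square power3_eq_cube\<close>)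
    have G1: "((\<lambda>x. G (1 - x ^ 3)) has_real_derivative (2/9) * F (1 - x ^ 3) * (- 3 * x\<^sup>2)) (at x)"
      by (rule DERIV_chain2[OF G' u']) (use x3 in auto)
    show "((\<lambda>x. - 3 * G (1 - x ^ 3)) has_real_derivative 2 * x\<^sup>2 * F (1 - x ^ 3)) (at x)"
      by (rule derivative_eq_intros G1 refl)+ simp
    have P_eq: "P x = x * (1 - x) * (1 + x + x\<^sup>2)"
      by (simp add: P_def algebra_simps power2_eq_square power3_eq_cube)
    have pos: "1 + 2 * x > 0" "1 + x + x\<^sup>2 > 0" using x by (auto simp: add_pos_pos)
    \<comment> \<open>The substitution \<open>t = y x ^ 3\<close> turns the weight
      \<open>t (1 - t)\<close> into a multiple of the same \<open>P\<close> that belongs to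
      \<open>1 - x ^ 3\<close>.\<close>
    have S: "- 9 * (y x)\<^sup>2 / (1 + 2 * x)\<^sup>2 / (y x ^ 3 * (1 - y x ^ 3)) = - (1 + 2 * x)\<^sup>2 / P x"
    proof -
      have e1: "- 9 * (y x)\<^sup>2 / (1 + 2 * x)\<^sup>2 / (y x ^ 3 * (1 - y x ^ 3)) =
          - 9 / (1 + 2 * x)\<^sup>2 / (y x * (1 - y x ^ 3))"
        using y01[OF x] by (simp add: power2_eq_square power3_eq_cube)
      have e2: "y x * (1 - y x ^ 3) = 9 * P x / (1 + 2 * x) ^ 4"
        unfolding one_y3[OF x] by (simp add: y_def P_eq power4_eq_xxxx power3_eq_cube mult_ac)
      show ?thesis unfolding e1 e2 using pos P
        by (simp add: divide_simps power4_eq_xxxx power2_eq_square)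
    qed
    have F3: "((\<lambda>x. F (y x ^ 3)) has_real_derivative - (1 + 2 * x)\<^sup>2 / P x * G (y x ^ 3)) (at x)"
      unfolding S[symmetric]
      by (rule DERIV_cong[OF DERIV_chain2[OF F' y3]]) (use x y3_01 in \<open>auto simp: mult_ac\<close>)
    have G3: "((\<lambda>x. G (y x ^ 3)) has_real_derivative
        - 2 * (y x)\<^sup>2 / (1 + 2 * x)\<^sup>2 * F (y x ^ 3)) (at x)"
      by (rule DERIV_cong[OF DERIV_chain2[OF G' y3]]) (use x y3_01 in \<open>auto simp: mult_ac\<close>)
    define d where "d = 1 + 2 * x"
    have d: "d \<noteq> 0" using pos by (simp add: d_def)
    have m': "((\<lambda>x. 3 / (1 + 2 * x)) has_real_derivative - 6 / d\<^sup>2) (at x)"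
      unfolding d_def by (rule derivative_eq_intros refl)+ (use pos in \<open>auto simp: power2_eq_square\<close>)
    show "((\<lambda>x. 3 / (1 + 2 * x) * F (y x ^ 3)) has_real_derivative
        (- 6 * P x / (1 + 2 * x)\<^sup>2 * F (y x ^ 3) - 3 * (1 + 2 * x) * G (y x ^ 3)) / P x) (at x)"
      by (rule DERIV_cong[OF DERIV_mult[OF m' F3]], unfold d_def[symmetric])
         (use d P in \<open>simp add: divide_simps power2_eq_square\<close>)
    define A where "A = - 6 * (1 - 2 * x - 4 * x ^ 3 - 4 * x ^ 4) / d ^ 3"
    have D: "((\<lambda>x. (x - x ^ 4) / (1 + 2 * x)\<^sup>2) has_real_derivative
        ((1 - 4 * x ^ 3) * d\<^sup>2 - (x - x ^ 4) * (4 * d)) / d ^ 4) (at x)"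
      unfolding d_def by (rule derivative_eq_intros refl)+
        (use pos in \<open>auto simp: power2_eq_square power4_eq_xxxx\<close>)
    have D_eq: "- 6 * (((1 - 4 * x ^ 3) * d\<^sup>2 - (x - x ^ 4) * (4 * d)) / d ^ 4) = A"
    proof -
      have "((1 - 4 * x ^ 3) * d\<^sup>2 - (x - x ^ 4) * (4 * d)) = d * (1 - 2 * x - 4 * x ^ 3 - 4 * x ^ 4)"
        unfolding d_def by algebra
      then show ?thesis using d by (simp add: A_def power4_eq_xxxx power3_eq_cube)
    qed
    have "((\<lambda>x. - 6 * ((x - x ^ 4) / (1 + 2 * x)\<^sup>2)) has_real_derivative A) (at x)"
      by (rule DERIV_cong[OF DERIV_cmult[OF D] D_eq])
    then have A': "((\<lambda>x. - 6 * P x / (1 + 2 * x)\<^sup>2) has_real_derivative A) (at x)"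
      by (simp add: P_def power4_eq_xxxx power3_eq_cube right_diff_distrib mult.assoc)
    \<comment> \<open>The first term is \<open>2 * x^2\<close> times the multiplier
      \<open>3 / d\<close>, as the equation demands; the second cancels what the derivative of
      \<open>G (y x ^ 3)\<close> contributes.\<close>
    have A_eq: "A = 6 * x\<^sup>2 / d - 6 * (y x)\<^sup>2 / d"
    proof -
      have "- 6 * (1 - 2 * x - 4 * x ^ 3 - 4 * x ^ 4) = 6 * x\<^sup>2 * d\<^sup>2 - 6 * (1 - x)\<^sup>2"
        unfolding d_def by algebra
      then have "A = (6 * x\<^sup>2 * d\<^sup>2 - 6 * (1 - x)\<^sup>2) / d ^ 3"
        by (simp add: A_def)
      moreover have "(y x)\<^sup>2 = (1 - x)\<^sup>2 / d\<^sup>2" by (simp add: y_def d_def power_divide)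
      ultimately show ?thesis using d
        by (simp add: diff_divide_distrib power2_eq_square power3_eq_cube)
    qed
    have B': "((\<lambda>x. 3 * (1 + 2 * x)) has_real_derivative 6) (at x)"
      by (rule derivative_eq_intros refl)+ simp
    have "(6 * x\<^sup>2 / d - 6 * (y x)\<^sup>2 / d) * f + - d\<^sup>2 / P x * g * (- 6 * P x / d\<^sup>2)
        - (6 * g + - 2 * (y x)\<^sup>2 / d\<^sup>2 * f * (3 * d)) = 2 * x\<^sup>2 * (3 / d * f)" for f g
    proof -
      have "- d\<^sup>2 / P x * g * (- 6 * P x / d\<^sup>2) = 6 * g" using d P by simp
      moreover have "- 2 * (y x)\<^sup>2 / d\<^sup>2 * f * (3 * d) = - 6 * (y x)\<^sup>2 / d * f"
        using d by (simp add: power2_eq_square)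
      ultimately show ?thesis by (simp add: left_diff_distrib)
    qed
    then show "((\<lambda>x. - 6 * P x / (1 + 2 * x)\<^sup>2 * F (y x ^ 3) - 3 * (1 + 2 * x) * G (y x ^ 3))
        has_real_derivative 2 * x\<^sup>2 * (3 / (1 + 2 * x) * F (y x ^ 3))) (at x)"
      by (intro DERIV_cong[OF DERIV_diff[OF DERIV_mult[OF A' F3] DERIV_mult[OF B' G3]]])
         (simp only: d_def[symmetric] A_eq)
  next
    show "isCont (\<lambda>x. F (1 - x ^ 3)) 1" "isCont (\<lambda>x. - 3 * G (1 - x ^ 3)) 1"
      "isCont (\<lambda>x. 3 / (1 + 2 * x) * F (y x ^ 3)) 1"
      "isCont (\<lambda>x. - 6 * P x / (1 + 2 * x)\<^sup>2 * F (y x ^ 3) - 3 * (1 + 2 * x) * G (y x ^ 3)) 1"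
      unfolding F_def G_def y_def P_def
      by (intro continuous_intros isCont_hgF isCont_hgG; simp)+
  qed (use x in \<open>auto simp: F_def G_def P_def y_def\<close>)
  then show ?thesis using x by (simp add: F_def y_def field_simps)
qed

text \<open>In the variable \<open>s = \<surd>(1 + 8 \<alpha>)\<close> both sides of the relation between \<open>a = 1/6\<close> and \<open>a = 1/3\<close>
  solve \<open>(P Y')' = 8/9 s Y\<close>. Here \<open>F\<close> is \<open>F\<^sub>1\<^sub>/\<^sub>6\<close> or its reflection \<open>t \<mapsto> F\<^sub>1\<^sub>/\<^sub>6(1 - t)\<close>.\<close>
lemma hgF_sextic_cubic_ODE:
  fixes s :: real and F G P be m :: "real \<Rightarrow> real"
  assumes s: "1 < s" "s < 3"
  defines "P \<equiv> \<lambda>s. (s\<^sup>2 - 1) * (9 - s\<^sup>2) / s"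
    and "be \<equiv> \<lambda>s. (s - 1) * (s + 3) ^ 3 / (16 * s ^ 3)"
    and "m \<equiv> \<lambda>s. s powr (- 1/2)"
  assumes F: "\<And>t. 0 < t \<Longrightarrow> t < 1 \<Longrightarrow> (F has_real_derivative G t / (t * (1 - t))) (at t)"
    and G: "\<And>t. 0 < t \<Longrightarrow> t < 1 \<Longrightarrow> (G has_real_derivative (5/36) * F t) (at t)"
  shows "((\<lambda>s. m s * F (be s)) has_real_derivative
      (16 * m s * s * G (be s) - m s * P s / (2 * s) * F (be s)) / P s) (at s)"
    and "((\<lambda>s. 16 * m s * s * G (be s) - m s * P s / (2 * s) * F (be s)) has_real_derivative
      8/9 * s * (m s * F (be s))) (at s)"
proof -
  have s0: "s \<noteq> 0" "0 < s" using s by auto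
  have "1 < s\<^sup>2" "s\<^sup>2 < 9"
    using s power_strict_mono[of 1 s 2] power_strict_mono[of s 3 2] by auto
  then have s2: "s\<^sup>2 - 1 \<noteq> 0" "9 - s\<^sup>2 \<noteq> 0" by linarith+
  then have P: "P s \<noteq> 0" using s0 unfolding P_def by simp
  have one_be: "1 - be s = (s + 1) * (3 - s) ^ 3 / (16 * s ^ 3)"
  proof -
    have "16 * s ^ 3 - (s - 1) * (s + 3) ^ 3 = (s + 1) * (3 - s) ^ 3" by algebra
    then show ?thesis using s0 unfolding be_def by (simp add: diff_divide_eq_iff)
  qed
  have be01: "0 < be s" "be s < 1"
  proof -
    show "0 < be s" using s by (simp add: be_def)
    have "0 < 1 - be s" unfolding one_be using s by simp
    then show "be s < 1" by simp
  qed
  have be': "(be has_real_derivative (9 - s\<^sup>2)\<^sup>2 / (16 * s ^ 4)) (at s)"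
  proof -
    have D: "(be has_real_derivative
      (((s + 3) ^ 3 + (s - 1) * (3 * (s + 3)\<^sup>2)) * (16 * s ^ 3) - (s - 1) * (s + 3) ^ 3 * (48 * s\<^sup>2))
        / (16 * s ^ 3)\<^sup>2) (at s)"
      unfolding be_def
      by (rule derivative_eq_intros refl)+ (use s0 in \<open>auto simp: power2_eq_square algebra_simps\<close>)
    have e1: "((s + 3) ^ 3 + (s - 1) * (3 * (s + 3)\<^sup>2)) * (16 * s ^ 3) - (s - 1) * (s + 3) ^ 3 * (48 * s\<^sup>2)
        = 16 * s\<^sup>2 * (9 - s\<^sup>2)\<^sup>2" by algebra
    have e2: "16 * s\<^sup>2 * c / (16 * s ^ 3)\<^sup>2 = c / (16 * s ^ 4)" for c
      using s0 by (simp add: power_mult_distrib power2_eq_square power3_eq_cube power4_eq_xxxx)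
    show ?thesis using D unfolding e1 e2 .
  qed
  have m': "(m has_real_derivative - m s / (2 * s)) (at s)"
  proof -
    have "(m has_real_derivative - 1/2 * s powr (- 1/2 - 1)) (at s)"
      unfolding m_def by (rule derivative_eq_intros refl s0)+ simp
    moreover have "s powr (- 1/2 - 1) = m s / s"
      unfolding m_def by (subst powr_diff) (use s0 in simp)
    ultimately show ?thesis by (simp add: mult.commute)
  qed
  \<comment> \<open>The logarithmic-type factor \<open>t' / (t (1 - t))\<close> at
    \<open>t = be s\<close>: it carries the weight of the equation for \<open>F\<close> over to
    \<open>P\<close>.\<close>
  have S: "(9 - s\<^sup>2)\<^sup>2 / (16 * s ^ 4) / (be s * (1 - be s)) = 16 * s / P s"
  proof -
    have "be s * (1 - be s) = (s\<^sup>2 - 1) * (9 - s\<^sup>2) ^ 3 / (256 * s ^ 6)"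
    proof -
      have "(s - 1) * (s + 3) ^ 3 * ((s + 1) * (3 - s) ^ 3) = (s\<^sup>2 - 1) * (9 - s\<^sup>2) ^ 3" by algebra
      then show ?thesis unfolding one_be unfolding be_def
        by (simp add: power_add[symmetric])
    qed
    moreover have "s ^ 6 = s * s * s ^ 4" by (simp add: power_numeral_reduce)
    ultimately show ?thesis using s0 s2
      by (simp add: P_def power2_eq_square power3_eq_cube)
  qed
  have F': "((\<lambda>s. F (be s)) has_real_derivative 16 * s / P s * G (be s)) (at s)"
    unfolding S[symmetric] by (rule DERIV_cong[OF DERIV_chain2[OF F be']]) (use be01 in \<open>auto simp: mult_ac\<close>)
  have G': "((\<lambda>s. G (be s)) has_real_derivative 5/36 * F (be s) * ((9 - s\<^sup>2)\<^sup>2 / (16 * s ^ 4))) (at s)"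
    by (rule DERIV_chain2[OF G be']) (use be01 in auto)
  have "- m s / (2 * s) * f + 16 * s / P s * g * m s = (16 * m s * s * g - m s * P s / (2 * s) * f) / P s" for f g
    using P by (simp add: diff_divide_distrib)
  then show "((\<lambda>s. m s * F (be s)) has_real_derivative
      (16 * m s * s * G (be s) - m s * P s / (2 * s) * F (be s)) / P s) (at s)"
    by (intro DERIV_cong[OF DERIV_mult[OF m' F']])
  have A: "((\<lambda>s. P s / (2 * s)) has_real_derivative 9 / s ^ 3 - s) (at s)"
  proof -
    have "((\<lambda>s. (10 * s\<^sup>2 - s ^ 4 - 9) / (2 * s\<^sup>2)) has_real_derivative
        ((20 * s - 4 * s ^ 3) * (2 * s\<^sup>2) - (10 * s\<^sup>2 - s ^ 4 - 9) * (4 * s)) / (2 * s\<^sup>2)\<^sup>2) (at s)"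
      by (rule derivative_eq_intros refl)+ (use s0 in \<open>auto simp: power2_eq_square\<close>)
    moreover have "((20 * s - 4 * s ^ 3) * (2 * s\<^sup>2) - (10 * s\<^sup>2 - s ^ 4 - 9) * (4 * s)) / (2 * s\<^sup>2)\<^sup>2
        = 9 / s ^ 3 - s"
      using s0 by (simp add: divide_simps) algebra
    ultimately have "((\<lambda>s. (10 * s\<^sup>2 - s ^ 4 - 9) / (2 * s\<^sup>2)) has_real_derivative 9 / s ^ 3 - s) (at s)"
      by simp
    then show ?thesis
    proof (rule has_field_derivative_transform_within_open[where S = "{0<..}"])
      fix x :: real assume "x \<in> {0<..}"
      then show "(10 * x\<^sup>2 - x ^ 4 - 9) / (2 * x\<^sup>2) = P x / (2 * x)"
        by (simp add: P_def divide_simps) (simp add: algebra_simps power2_eq_square power4_eq_xxxx)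
    qed (use s0 in auto)
  qed
  have B: "((\<lambda>s. m s * P s / (2 * s)) has_real_derivative
     m s * (- 3 / 4 * s - 5 / (2 * s) + 45 / (4 * s ^ 3))) (at s)"
  proof -
    have "P s / (2 * s) = 5 - s\<^sup>2 / 2 - 9 / (2 * s\<^sup>2)"
      using s0 by (simp add: P_def divide_simps) (simp add: algebra_simps power2_eq_square)
    moreover have "- m s / (2 * s) * (5 - s\<^sup>2 / 2 - 9 / (2 * s\<^sup>2)) + (9 / s ^ 3 - s) * m s =
        m s * (- 3 / 4 * s - 5 / (2 * s) + 45 / (4 * s ^ 3))"
      using s0 by (simp add: divide_simps) algebra
    ultimately show ?thesis
      using DERIV_mult[OF m' A] by simp
  qed
  have C: "((\<lambda>s. 16 * m s * s) has_real_derivative 8 * m s) (at s)"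
    by (rule derivative_eq_intros m' refl)+ (use s0 in simp)
  \<comment> \<open>The multiplier \<open>s powr (- 1/2)\<close> is chosen so that the two terms in
    \<open>g\<close> cancel; what remains is a rational identity for the coefficient of
    \<open>f\<close>.\<close>
  have "8 * m s * g + 5/36 * f * ((9 - s\<^sup>2)\<^sup>2 / (16 * s ^ 4)) * (16 * m s * s)
      - (m s * (- 3 / 4 * s - 5 / (2 * s) + 45 / (4 * s ^ 3)) * f + 16 * s / P s * g * (m s * P s / (2 * s)))
      = 8/9 * s * (m s * f)" for f g
  proof -
    have g_eq: "16 * s / P s * g * (m s * P s / (2 * s)) = 8 * m s * g" using P s0 by simp
    have E: "(9 - s\<^sup>2)\<^sup>2 / (16 * s ^ 4) * (16 * s) = 81 / s ^ 3 - 18 / s + s"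
      using s0 by (simp add: divide_simps) algebra
    have f_eq: "5/36 * f * ((9 - s\<^sup>2)\<^sup>2 / (16 * s ^ 4)) * (16 * m s * s) = 5/36 * f * m s * (81 / s ^ 3 - 18 / s + s)"
      unfolding E[symmetric] by (simp only: mult_ac)
    have "5/36 * (81 / s ^ 3 - 18 / s + s) - (- 3 / 4 * s - 5 / (2 * s) + 45 / (4 * s ^ 3)) = 8/9 * s"
      using s0 by (simp add: divide_simps) algebra
    then have "8/9 * s * (m s * f) =
        f * m s * (5/36 * (81 / s ^ 3 - 18 / s + s) - (- 3 / 4 * s - 5 / (2 * s) + 45 / (4 * s ^ 3)))"
      by simp
    then show ?thesis unfolding g_eq f_eq by (simp only: algebra_simps)
  qed
  then show "((\<lambda>s. 16 * m s * s * G (be s) - m s * P s / (2 * s) * F (be s)) has_real_derivative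
      8/9 * s * (m s * F (be s))) (at s)"
    by (intro DERIV_cong[OF DERIV_diff[OF DERIV_mult[OF C G'] DERIV_mult[OF B F']]])
qed

text \<open>As \<open>s\<close> runs from 1 to 3, \<open>(s^2 - 1) / 8\<close> and \<beta> both run
  from 0 to 1. The first relation is normalised at \<open>s = 1\<close>, where both arguments are 0,
  the second at \<open>s = 3\<close>, where both reflected arguments are 0; there the multiplier
  \<open>3 powr (- 1/2)\<close> produces the factor \<open>sqrt 3\<close>.\<close>

lemma hgF_sextic_cubic:
  fixes s :: real
  assumes s: "1 < s" "s < 3"
  defines "\<beta> \<equiv> (s - 1) * (s + 3) ^ 3 / (16 * s ^ 3)"
  shows "hgF (1/6) \<beta> = sqrt s * hgF (1/3) ((s\<^sup>2 - 1) / 8)"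
    and "sqrt 3 * hgF (1/6) (1 - \<beta>) = sqrt s * hgF (1/3) (1 - (s\<^sup>2 - 1) / 8)"
proof -
  define P :: "real \<Rightarrow> real" where "P s = (s\<^sup>2 - 1) * (9 - s\<^sup>2) / s" for s
  define be :: "real \<Rightarrow> real" where "be s = (s - 1) * (s + 3) ^ 3 / (16 * s ^ 3)" for s
  define m :: "real \<Rightarrow> real" where "m s = s powr (- 1/2)" for s
  define al :: "real \<Rightarrow> real" where "al s = (s\<^sup>2 - 1) / 8" for s
  define Z where "Z F G s = 16 * m s * s * G (be s) - m s * P s / (2 * s) * F (be s)"
    for F G :: "real \<Rightarrow> real" and s
  note ODE = hgF_sextic_cubic_ODE[folded P_def be_def m_def, folded Z_def]
  have F3: "(hgF (1/3) has_real_derivative hgG (1/3) t / (t * (1 - t))) (at t)" if "0 < t" "t < 1" for t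
    by (rule hgF_deriv) (use that in auto)
  have G3: "(hgG (1/3) has_real_derivative (2/9) * hgF (1/3) t) (at t)" if "0 < t" "t < 1" for t
    using hgG_deriv[of "1/3" t] that by simp
  have F6: "(hgF (1/6) has_real_derivative hgG (1/6) t / (t * (1 - t))) (at t)" if "0 < t" "t < 1" for t
    by (rule hgF_deriv) (use that in auto)
  have G6: "(hgG (1/6) has_real_derivative (5/36) * hgF (1/6) t) (at t)" if "0 < t" "t < 1" for t
    using hgG_deriv[of "1/6" t] that by simp
  have one_minus: "((\<lambda>t. 1 - t) has_real_derivative - 1) (at t)" for t :: real
    by (rule derivative_eq_intros refl)+ simp
  \<comment> \<open>The first-order system is invariant under \<open>t \<mapsto> 1 - t\<close> once
    the sign of \<open>G\<close> is reversed.\<close>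
  have F6': "((\<lambda>t. hgF (1/6) (1 - t)) has_real_derivative - hgG (1/6) (1 - t) / (t * (1 - t))) (at t)"
    if "0 < t" "t < 1" for t
    by (rule DERIV_cong[OF DERIV_chain2[OF F6 one_minus]]) (use that in \<open>auto simp: mult_ac\<close>)
  have G6': "((\<lambda>t. - hgG (1/6) (1 - t)) has_real_derivative (5/36) * hgF (1/6) (1 - t)) (at t)"
    if "0 < t" "t < 1" for t
    by (rule DERIV_cong[OF DERIV_minus[OF DERIV_chain2[OF G6 one_minus]]]) (use that in auto)
  have sq: "1 < x\<^sup>2" "x\<^sup>2 < 9" if "1 < x" "x < 3" for x :: real
    using that power_strict_mono[of 1 x 2] power_strict_mono[of x 3 2] by auto
  have al01: "0 < al x" "al x < 1" if "1 < x" "x < 3" for x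
    using sq[OF that] unfolding al_def by auto
  have P: "P x \<noteq> 0" if "1 < x" "x < 3" for x
  proof -
    have "x\<^sup>2 - 1 \<noteq> 0" "9 - x\<^sup>2 \<noteq> 0" using sq[OF that] by linarith+
    then show ?thesis using that unfolding P_def by simp
  qed
  have al': "(al has_real_derivative x / 4) (at x)" for x
    unfolding al_def by (auto intro!: derivative_eq_intros)
  have al'': "((\<lambda>x. 1 - al x) has_real_derivative - (x / 4)) (at x)" for x
    by (rule derivative_eq_intros al' refl)+ simp
  have S: "c / (al x * (1 - al x)) * (x / 4) = 16 * c / P x" if "1 < x" "x < 3" for c x
  proof -
    have al: "al x * (1 - al x) = (x\<^sup>2 - 1) * (9 - x\<^sup>2) / 64"
      by (simp add: al_def field_simps)
    show ?thesis unfolding al P_def by (simp add: mult.commute)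
  qed
  have "m s * hgF (1/6) (be s) * hgF (1/3) (al 1) = m 1 * hgF (1/6) (be 1) * hgF (1/3) (al s)"
  proof (rule solutions_proportional[where l = 1 and u = 3 and P = P and Q = "\<lambda>x. 8/9 * x" and
        ?Y1.0 = "\<lambda>x. hgF (1/3) (al x)" and ?Z1.0 = "\<lambda>x. 16 * hgG (1/3) (al x)" and
        ?Z2.0 = "Z (hgF (1/6)) (hgG (1/6))"])
    fix x :: real assume x: "1 < x" "x < 3"
    show "((\<lambda>x. hgF (1/3) (al x)) has_real_derivative 16 * hgG (1/3) (al x) / P x) (at x)"
      by (rule DERIV_cong[OF DERIV_chain2[OF F3 al'] S]) (use x al01[OF x] in auto)
    show "((\<lambda>x. 16 * hgG (1/3) (al x)) has_real_derivative 8/9 * x * hgF (1/3) (al x)) (at x)"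
      by (rule DERIV_cong[OF DERIV_cmult[OF DERIV_chain2[OF G3 al']]]) (use al01[OF x] in auto)
    show "((\<lambda>x. m x * hgF (1/6) (be x)) has_real_derivative Z (hgF (1/6)) (hgG (1/6)) x / P x) (at x)"
      by (rule ODE(1)[OF x F6 G6])
    show "(Z (hgF (1/6)) (hgG (1/6)) has_real_derivative 8/9 * x * (m x * hgF (1/6) (be x))) (at x)"
      using ODE(2)[OF x F6 G6] by simp
    show "hgF (1/3) (al x) \<noteq> 0"
      using hgF_ge_1[of "1/3" "al x"] al01[OF x] by auto
  next
    show "isCont (\<lambda>x. hgF (1/3) (al x)) 1" "isCont (\<lambda>x. 16 * hgG (1/3) (al x)) 1"
      "isCont (\<lambda>x. m x * hgF (1/6) (be x)) 1" "isCont (Z (hgF (1/6)) (hgG (1/6))) 1"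
      unfolding al_def m_def be_def P_def Z_def
      by (intro continuous_intros isCont_hgF isCont_hgG; simp)+
  qed (use s P in \<open>auto simp: al_def be_def P_def Z_def\<close>)
  then have "m s * hgF (1/6) (be s) = hgF (1/3) (al s)"
    by (simp add: al_def be_def m_def)
  moreover have m: "sqrt s * m s = 1"
    using s by (simp add: m_def powr_minus powr_half_sqrt)
  ultimately show "hgF (1/6) \<beta> = sqrt s * hgF (1/3) ((s\<^sup>2 - 1) / 8)"
    unfolding \<beta>_def be_def[symmetric] al_def[symmetric] by (metis mult.assoc mult_1)
  have "m s * hgF (1/6) (1 - be s) * hgF (1/3) (1 - al 3) = m 3 * hgF (1/6) (1 - be 3) * hgF (1/3) (1 - al s)"
  proof (rule solutions_proportional[where l = 1 and u = 3 and P = P and Q = "\<lambda>x. 8/9 * x" and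
        ?Y1.0 = "\<lambda>x. hgF (1/3) (1 - al x)" and ?Z1.0 = "\<lambda>x. - 16 * hgG (1/3) (1 - al x)" and
        ?Z2.0 = "Z (\<lambda>t. hgF (1/6) (1 - t)) (\<lambda>t. - hgG (1/6) (1 - t))"])
    fix x :: real assume x: "1 < x" "x < 3"
    have S': "hgG (1/3) (1 - al x) / ((1 - al x) * (1 - (1 - al x))) * - (x / 4) =
        - 16 * hgG (1/3) (1 - al x) / P x"
      using S[OF x, of "hgG (1/3) (1 - al x)"] by (simp add: mult.commute)
    show "((\<lambda>x. hgF (1/3) (1 - al x)) has_real_derivative - 16 * hgG (1/3) (1 - al x) / P x) (at x)"
      by (rule DERIV_cong[OF DERIV_chain2[OF F3 al''] S']) (use x al01[OF x] in auto)
    show "((\<lambda>x. - 16 * hgG (1/3) (1 - al x)) has_real_derivative 8/9 * x * hgF (1/3) (1 - al x)) (at x)"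
      by (rule DERIV_cong[OF DERIV_cmult[OF DERIV_chain2[OF G3 al'']]]) (use al01[OF x] in auto)
    show "((\<lambda>x. m x * hgF (1/6) (1 - be x)) has_real_derivative
        Z (\<lambda>t. hgF (1/6) (1 - t)) (\<lambda>t. - hgG (1/6) (1 - t)) x / P x) (at x)"
      by (rule ODE(1)[OF x F6' G6'])
    show "(Z (\<lambda>t. hgF (1/6) (1 - t)) (\<lambda>t. - hgG (1/6) (1 - t)) has_real_derivative
        8/9 * x * (m x * hgF (1/6) (1 - be x))) (at x)"
      using ODE(2)[OF x F6' G6'] by simp
    show "hgF (1/3) (1 - al x) \<noteq> 0"
      using hgF_ge_1[of "1/3" "1 - al x"] al01[OF x] by auto
  next
    show "isCont (\<lambda>x. hgF (1/3) (1 - al x)) 3" "isCont (\<lambda>x. - 16 * hgG (1/3) (1 - al x)) 3"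
      "isCont (\<lambda>x. m x * hgF (1/6) (1 - be x)) 3"
      "isCont (Z (\<lambda>t. hgF (1/6) (1 - t)) (\<lambda>t. - hgG (1/6) (1 - t))) 3"
      unfolding al_def m_def be_def P_def Z_def
      by (intro continuous_intros isCont_hgF isCont_hgG; simp)+
  qed (use s P in \<open>auto simp: al_def be_def P_def Z_def\<close>)
  then have "m s * hgF (1/6) (1 - be s) = m 3 * hgF (1/3) (1 - al s)"
    by (simp add: al_def be_def)
  moreover have "sqrt 3 * m 3 = 1"
    by (simp add: m_def powr_minus powr_half_sqrt)
  moreover have "sqrt 3 * hgF (1/6) (1 - be s) = sqrt s * sqrt 3 * (m s * hgF (1/6) (1 - be s))"
    using m by (simp add: mult_ac)
  ultimately show "sqrt 3 * hgF (1/6) (1 - \<beta>) = sqrt s * hgF (1/3) (1 - (s\<^sup>2 - 1) / 8)"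
    unfolding \<beta>_def be_def[symmetric] al_def[symmetric] by (metis mult.assoc mult_1)
qed

section \<open>The logarithmic singularity at \<open>1\<close>\<close>

lemma Gamma_reflection_real: "Gamma a * Gamma (1 - a) = pi / sin (pi * a)" for a :: real
proof -
  have "complex_of_real (Gamma a * Gamma (1 - a)) = Gamma (complex_of_real a) * Gamma (1 - complex_of_real a)"
    by (simp add: Gamma_complex_of_real[symmetric])
  also have "\<dots> = complex_of_real (pi / sin (pi * a))"
    by (simp add: Gamma_reflection_complex sin_of_real[symmetric])
  finally show ?thesis by (simp only: of_real_eq_iff)
qed

text \<open>Up to inversion, \<open>n * hg_coeff a n\<close> is the product of the Euler
  approximants of \<open>Gamma a\<close> and \<open>Gamma (1 - a)\<close>, whose powers of
  \<open>n\<close> multiply to \<open>n\<close>. The limit is then the reflection formula.\<close>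

lemma hg_coeff_asymp:
  assumes a: "0 < a" "a < 1"
  shows "(\<lambda>n. real n * hg_coeff a n) \<longlonglongrightarrow> sin (pi * a) / pi"
proof -
  have "(\<lambda>n. Gamma_series' a n * Gamma_series' (1 - a) n) \<longlonglongrightarrow> pi / sin (pi * a)"
    unfolding Gamma_reflection_real[symmetric] by (intro tendsto_mult Gamma_series'_LIMSEQ)
  moreover have "sin (pi * a) > 0" using a by (intro sin_gt_zero) auto
  ultimately have "(\<lambda>n. inverse (Gamma_series' a n * Gamma_series' (1 - a) n)) \<longlonglongrightarrow> inverse (pi / sin (pi * a))"
    by (intro tendsto_inverse) auto
  moreover have "\<forall>\<^sub>F n in sequentially.
      inverse (Gamma_series' a n * Gamma_series' (1 - a) n) = real n * hg_coeff a n"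
    using eventually_gt_at_top[of 0]
  proof eventually_elim
    case (elim n)
    have "exp (a * ln (real n)) * exp ((1 - a) * ln (real n)) = real n"
      using elim by (simp add: exp_add[symmetric] algebra_simps)
    moreover have "fact n = real n * fact (n - 1)"
      using elim by (simp add: fact_reduce)
    moreover have "Gamma_series' a n * Gamma_series' (1 - a) n =
      (fact (n - 1))\<^sup>2 * (exp (a * ln (real n)) * exp ((1 - a) * ln (real n))) / (pochhammer a n * pochhammer (1 - a) n)"
      by (simp add: Gamma_series'_def power2_eq_square)
    ultimately show ?case using elim
      by (simp add: hg_coeff_def power2_eq_square)
  qed
  ultimately show ?thesis
    using Lim_transform_eventually by fastforce
qed

text \<open>An Abelian comparison: the coefficients of \<open>hgF a\<close> are asymptotic to
  \<kappa>\<open>/ n\<close>, those of -\<kappa>\<open>ln (1 - t)\<close>. The two series at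
  \<open>t = 1 - x\<close> then differ by at most a constant plus a small multiple of
  \<open>- ln x\<close>.\<close>

lemma hgF_log_asymp:
  assumes a: "0 < a" "a < 1"
  shows "((\<lambda>x. hgF a (1 - x) / (- ln x)) \<longlongrightarrow> sin (pi * a) / pi) (at_right 0)"
proof (rule tendstoI)
  define \<kappa> where "\<kappa> = sin (pi * a) / pi"
  fix \<epsilon> :: real assume \<epsilon>: "0 < \<epsilon>"
  have "\<forall>\<^sub>F n in sequentially. dist (real n * hg_coeff a n) \<kappa> < \<epsilon> / 2"
    using hg_coeff_asymp[OF a] \<epsilon> unfolding \<kappa>_def by (intro tendstoD) auto
  then obtain N where N: "\<And>n. n \<ge> N \<Longrightarrow> \<bar>real n * hg_coeff a n - \<kappa>\<bar> < \<epsilon> / 2"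
    by (auto simp: eventually_sequentially dist_real_def)
  \<comment> \<open>The sum dominates the terms before \<open>N\<close>. The extra 1 covers the
    constant term when \<open>N = 0\<close>, where \<kappa>\<open>/ 0\<close> is 0 by
    convention.\<close>
  define C where "C = 1 + (\<Sum>n<N. \<bar>hg_coeff a n - \<kappa> / n\<bar>)"
  have bound: "\<bar>hgF a (1 - x) - \<kappa> * (- ln x)\<bar> \<le> C + \<epsilon> / 2 * (- ln x)" if x: "0 < x" "x < 1" for x
  proof -
    define t where "t = 1 - x"
    have t: "0 < t" "t < 1" using x by (auto simp: t_def)
    have "(\<lambda>n. - (t ^ n) / real n) sums ln x"
      using ln_series'[of "- t"] t by (simp add: t_def)
    then have L: "(\<lambda>n. t ^ n / real n) sums (- ln x)"
      using sums_minus by fastforce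
    have F: "(\<lambda>n. hg_coeff a n * t ^ n) sums hgF a t"
      using summable_hg[OF a, of t] t by (simp add: hgF_def summable_sums)
    have D: "(\<lambda>n. hg_coeff a n * t ^ n - \<kappa> * (t ^ n / real n)) sums (hgF a t - \<kappa> * (- ln x))"
      by (intro sums_diff F sums_mult L)
    define B where "B n = (if n < N then \<bar>hg_coeff a n - \<kappa> / n\<bar> else 0)" for n
    have B: "B sums (C - 1)"
      unfolding B_def C_def using sums_If_finite_set[of "{..<N}" "\<lambda>n. \<bar>hg_coeff a n - \<kappa> / n\<bar>"] by simp
    have E: "(\<lambda>n. B n + (if n = 0 then 1 else 0) + \<epsilon> / 2 * (t ^ n / real n)) sums (C + \<epsilon> / 2 * (- ln x))"
    proof -
      have "(\<lambda>n. B n + (if n = 0 then 1 else 0) + \<epsilon> / 2 * (t ^ n / real n)) sums (C - 1 + 1 + \<epsilon> / 2 * (- ln x))"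
        using sums_single[of 0 "\<lambda>_. 1 :: real"] by (intro sums_add B sums_mult L) auto
      then show ?thesis by simp
    qed
    have le: "\<bar>hg_coeff a n * t ^ n - \<kappa> * (t ^ n / real n)\<bar> \<le>
        B n + (if n = 0 then 1 else 0) + \<epsilon> / 2 * (t ^ n / real n)" for n
    proof -
      have eq: "\<bar>hg_coeff a n * t ^ n - \<kappa> * (t ^ n / real n)\<bar> = \<bar>hg_coeff a n - \<kappa> / n\<bar> * t ^ n"
      proof -
        have "hg_coeff a n * t ^ n - \<kappa> * (t ^ n / real n) = (hg_coeff a n - \<kappa> / n) * t ^ n"
          by (simp add: left_diff_distrib)
        then show ?thesis using t by (simp add: abs_mult)
      qed
      have tn: "0 \<le> t ^ n" "t ^ n \<le> 1" using t by (auto simp: power_le_one)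
      consider "n < N" | "n \<ge> N" "n = 0" | "n \<ge> N" "n > 0" by linarith
      then show ?thesis
      proof cases
        case 1
        have "\<bar>hg_coeff a n - \<kappa> / n\<bar> * t ^ n \<le> B n"
          using tn 1 by (simp add: B_def mult_left_le)
        moreover have "0 \<le> \<epsilon> / 2 * (t ^ n / real n)" using tn \<epsilon> by simp
        moreover have "0 \<le> (if n = 0 then 1 else 0 :: real)" by simp
        ultimately show ?thesis unfolding eq by linarith
      next
        case 2
        then show ?thesis using t by (simp add: B_def)
      next
        case 3
        have "\<bar>hg_coeff a n - \<kappa> / n\<bar> * real n = \<bar>real n * hg_coeff a n - \<kappa>\<bar>"
        proof -
          have "real n * hg_coeff a n - \<kappa> = (hg_coeff a n - \<kappa> / n) * real n"
            using 3 by (simp add: left_diff_distrib)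
          then show ?thesis by (simp add: abs_mult)
        qed
        also have "\<dots> \<le> \<epsilon> / 2" using N[of n] 3 by simp
        finally have "\<bar>hg_coeff a n - \<kappa> / n\<bar> \<le> \<epsilon> / 2 / real n"
          using 3 by (simp add: field_simps)
        then have "\<bar>hg_coeff a n - \<kappa> / n\<bar> * t ^ n \<le> \<epsilon> / 2 / real n * t ^ n"
          using tn by (intro mult_right_mono) auto
        then show ?thesis unfolding eq using 3 by (simp add: B_def)
      qed
    qed
    have "hgF a t - \<kappa> * (- ln x) \<le> C + \<epsilon> / 2 * (- ln x)"
      by (rule sums_le[OF _ D E]) (use le abs_le_D1 in blast)
    moreover have "- (hgF a t - \<kappa> * (- ln x)) \<le> C + \<epsilon> / 2 * (- ln x)"
      by (rule sums_le[OF _ sums_minus[OF D] E]) (use le abs_le_D2 in blast)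
    ultimately show ?thesis by (simp add: t_def abs_le_iff)
  qed
  \<comment> \<open>For \<open>x\<close> below \<delta> the quantity \<open>- ln x\<close> exceeds
    \<open>2 * C / \<epsilon>\<close>, so the constant \<open>C\<close> is absorbed into the other
    half of \<epsilon>.\<close>
  define \<delta> where "\<delta> = min (1 / 2) (exp (- (2 * C / \<epsilon> + 1)))"
  have \<delta>: "0 < \<delta>" "\<delta> < 1" by (auto simp: \<delta>_def)
  have "dist (hgF a (1 - x) / (- ln x)) \<kappa> < \<epsilon>" if x: "0 < x" "x < \<delta>" for x
  proof -
    have "ln x < ln (exp (- (2 * C / \<epsilon> + 1)))"
      using x by (subst ln_less_cancel_iff) (auto simp: \<delta>_def)
    then have l: "2 * C / \<epsilon> + 1 < - ln x" by simp
    have C: "0 \<le> C" by (simp add: C_def sum_nonneg add_nonneg_nonneg)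
    then have l0: "0 < - ln x" using l \<epsilon> by (smt (verit) divide_nonneg_pos)
    have "2 * C < \<epsilon> * (- ln x)" using l \<epsilon> by (simp add: field_simps)
    then have "\<bar>hgF a (1 - x) - \<kappa> * (- ln x)\<bar> < \<epsilon> * (- ln x)"
      using bound[of x] x \<delta> by linarith
    then have "\<bar>hgF a (1 - x) - \<kappa> * (- ln x)\<bar> / (- ln x) < \<epsilon>"
      using l0 by (simp only: pos_divide_less_eq)
    moreover have "hgF a (1 - x) / (- ln x) - \<kappa> = (hgF a (1 - x) - \<kappa> * (- ln x)) / (- ln x)"
      using l0 by (simp add: field_simps)
    ultimately show ?thesis
      by (simp only: dist_real_def abs_divide abs_of_pos[OF l0])
  qed
  then show "\<forall>\<^sub>F x in at_right 0. dist (hgF a (1 - x) / (- ln x)) (sin (pi * a) / pi) < \<epsilon>"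
    unfolding \<kappa>_def[symmetric] eventually_at_right_field using \<delta> by blast
qed

section \<open>The cubic theta functions\<close>

text \<open>The pair \<open>(m, n)\<close> stands for the Eisenstein integer \<open>m - n \<omega>\<close>, \<open>\<omega>\<^sup>2 + \<omega> + 1 = 0\<close>. Then \<open>eis_norm\<close> is
  its norm, \<open>eis_class\<close> its residue class modulo \<open>\<lambda> = 1 - \<omega>\<close>, and \<open>eis_shift + 1/3\<close> is the norm of its
  translate by an element of \<open>\<lambda>\<^sup>-\<^sup>1\<int>[\<omega>]\<close>. In coordinates, \<open>\<omega> (m, n) = (n, - m - n)\<close> and
  \<open>\<lambda> (m, n) = (m - n, m + 2 n)\<close>.\<close>

definition eis_norm :: "int \<times> int \<Rightarrow> int" where
  "eis_norm = (\<lambda>(m, n). m\<^sup>2 + m * n + n\<^sup>2)"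

definition eis_shift :: "int \<times> int \<Rightarrow> int" where
  "eis_shift = (\<lambda>(m, n). m\<^sup>2 + m * n + n\<^sup>2 + m + n)"

definition eis_class :: "int \<times> int \<Rightarrow> int" where
  "eis_class = (\<lambda>(m, n). (m - n) mod 3)"

lemma cubic_theta_a_eq: "cubic_theta_a q = (\<Sum>\<^sub>\<infinity>z. q powr eis_norm z)"
  by (simp add: cubic_theta_a_def eis_norm_def case_prod_unfold)

lemma cubic_theta_c_eq: "cubic_theta_c q = (\<Sum>\<^sub>\<infinity>z. q powr (eis_shift z + 1/3))"
  unfolding cubic_theta_c_def eis_shift_def
  by (rule infsum_cong) (auto simp: power2_eq_square algebra_simps)

section \<open>Convergence of the lattice sums\<close>

lemma has_sum_Sigma_nonneg:
  fixes f :: "'a \<times> 'b \<Rightarrow> real"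
  assumes "\<And>x. x \<in> A \<Longrightarrow> ((\<lambda>y. f (x, y)) has_sum g x) (B x)" "(g has_sum S) A"
    and "\<And>x y. x \<in> A \<Longrightarrow> y \<in> B x \<Longrightarrow> 0 \<le> f (x, y)"
  shows "(f has_sum S) (Sigma A B)"
  by (rule has_sum_SigmaI[OF assms(1,2) summable_on_SigmaI[OF assms(1) has_sum_imp_summable[OF assms(2)] assms(3)]])

lemma summable_on_int_power:
  fixes \<rho> :: real
  assumes "0 \<le> \<rho>" "\<rho> < 1"
  shows "(\<lambda>n::int. \<rho> ^ nat \<bar>n\<bar>) summable_on UNIV"
proof -
  have "summable (\<lambda>n. \<rho> ^ n)" using assms by (intro summable_geometric) auto
  then have *: "(\<lambda>n. \<rho> ^ n) summable_on UNIV"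
    using assms by (intro norm_summable_imp_summable_on) auto
  have "(\<lambda>n::int. \<rho> ^ nat \<bar>n\<bar>) summable_on range int"
    using * by (subst summable_on_reindex) (auto simp: o_def)
  moreover have "(\<lambda>n::int. \<rho> ^ nat \<bar>n\<bar>) summable_on range (\<lambda>n. - int n)"
    using * by (subst summable_on_reindex) (auto simp: o_def inj_on_def)
  moreover have "(UNIV :: int set) = range int \<union> range (\<lambda>n. - int n)"
  proof (intro UNIV_eq_I)
    show "n \<in> range int \<union> range (\<lambda>n. - int n)" for n
      by (cases n rule: int_cases2) auto
  qed
  ultimately show ?thesis using summable_on_union by metis
qed

text \<open>A lower bound of the exponent that is linear in
  \<open>\<bar>m\<bar> + \<bar>n\<bar>\<close> allows comparison with a product of two geometric
  series of ratio \<open>sqrt q\<close>. It serves both the norm and its shifted form.\<close>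

lemma summable_on_eis:
  fixes q c :: real and f :: "int \<times> int \<Rightarrow> real"
  assumes q: "0 < q" "q < 1" and f: "\<And>m n. f (m, n) \<ge> (real_of_int \<bar>m\<bar> + real_of_int \<bar>n\<bar>) / 2 - c"
  shows "(\<lambda>z. q powr f z) summable_on A"
proof -
  define \<rho> where "\<rho> = q powr (1/2)"
  have \<rho>: "0 < \<rho>" "\<rho> < 1" using q by (auto simp: \<rho>_def powr_half_sqrt)
  define S where "S = (\<Sum>\<^sub>\<infinity>n::int. \<rho> ^ nat \<bar>n\<bar>)"
  have S: "((\<lambda>n::int. \<rho> ^ nat \<bar>n\<bar>) has_sum S) UNIV"
    unfolding S_def using summable_on_int_power[of \<rho>] \<rho> by (intro has_sum_infsum) auto
  have "((\<lambda>(m, n). \<rho> ^ nat \<bar>m\<bar> * \<rho> ^ nat \<bar>n\<bar>) has_sum (S * S)) (Sigma UNIV (\<lambda>_. UNIV :: int set))"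
  proof (rule has_sum_Sigma_nonneg)
    show "((\<lambda>n. case (m, n) of (m, n) \<Rightarrow> \<rho> ^ nat \<bar>m\<bar> * \<rho> ^ nat \<bar>n\<bar>) has_sum \<rho> ^ nat \<bar>m\<bar> * S) UNIV" for m :: int
      using has_sum_cmult_right[OF S] by simp
    show "((\<lambda>m::int. \<rho> ^ nat \<bar>m\<bar> * S) has_sum S * S) UNIV"
      by (rule has_sum_cmult_left[OF S])
  qed (use \<rho> in auto)
  then have "(\<lambda>z. q powr (- c) * (case z of (m :: int, n :: int) \<Rightarrow> \<rho> ^ nat \<bar>m\<bar> * \<rho> ^ nat \<bar>n\<bar>)) summable_on UNIV"
    by (intro summable_on_cmult_right) (auto dest: has_sum_imp_summable)
  then have "(\<lambda>z. q powr f z) summable_on UNIV"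
  proof (rule summable_on_comparison_test)
    fix z :: "int \<times> int"
    obtain m n where z: "z = (m, n)" by (cases z)
    have "q powr f z \<le> q powr ((real_of_int \<bar>m\<bar> + real_of_int \<bar>n\<bar>) / 2 - c)"
      using f[of m n] q unfolding z by (intro powr_mono') auto
    also have "\<dots> = q powr (- c) * (\<rho> powr real_of_int \<bar>m\<bar> * \<rho> powr real_of_int \<bar>n\<bar>)"
      unfolding \<rho>_def powr_powr powr_add[symmetric] by (simp add: algebra_simps add_divide_distrib)
    also have "\<rho> powr real_of_int \<bar>m\<bar> * \<rho> powr real_of_int \<bar>n\<bar> = \<rho> ^ nat \<bar>m\<bar> * \<rho> ^ nat \<bar>n\<bar>"
      using \<rho> by (simp add: powr_realpow[symmetric])
    finally show "q powr f z \<le> q powr (- c) * (case z of (m, n) \<Rightarrow> \<rho> ^ nat \<bar>m\<bar> * \<rho> ^ nat \<bar>n\<bar>)"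
      by (simp add: z)
  qed auto
  then show ?thesis by (rule summable_on_subset_banach) auto
qed

lemma int_abs_le_square: "\<bar>m\<bar> \<le> m\<^sup>2" for m :: int
proof -
  have "\<bar>m\<bar> * 1 \<le> \<bar>m\<bar> * \<bar>m\<bar>"
    by (cases "m = 0") (simp, intro mult_left_mono, linarith+)
  then show ?thesis by (simp add: power2_eq_square)
qed

lemma eis_norm_ge: "2 * eis_norm (m, n) \<ge> \<bar>m\<bar> + \<bar>n\<bar>"
proof -
  have "2 * eis_norm (m, n) = (m + n)\<^sup>2 + m\<^sup>2 + n\<^sup>2"
    by (simp add: eis_norm_def power2_eq_square algebra_simps)
  moreover have "0 \<le> (m + n)\<^sup>2" by simp
  ultimately show ?thesis using int_abs_le_square[of m] int_abs_le_square[of n] by linarith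
qed

lemma eis_shift_ge: "2 * eis_shift (m, n) \<ge> \<bar>m\<bar> + \<bar>n\<bar> - 1"
proof -
  have "2 * eis_shift (m, n) = (m + n + 1)\<^sup>2 + m\<^sup>2 + n\<^sup>2 - 1"
    by (simp add: eis_shift_def power2_eq_square algebra_simps)
  moreover have "0 \<le> (m + n + 1)\<^sup>2" by simp
  ultimately show ?thesis using int_abs_le_square[of m] int_abs_le_square[of n] by linarith
qed

lemma eis_norm_nonneg: "0 \<le> eis_norm z"
  using eis_norm_ge[of "fst z" "snd z"] by simp

lemma eis_shift_nonneg: "0 \<le> eis_shift z"
  using eis_shift_ge[of "fst z" "snd z"] by simp

lemma summable_eis_norm:
  assumes "0 < q" "q < 1" shows "(\<lambda>z. q powr eis_norm z) summable_on A"
proof (rule summable_on_eis[OF assms, where c = 0])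
  show "(real_of_int \<bar>m\<bar> + real_of_int \<bar>n\<bar>) / 2 - 0 \<le> real_of_int (eis_norm (m, n))" for m n
  proof -
    have "real_of_int (\<bar>m\<bar> + \<bar>n\<bar>) \<le> real_of_int (2 * eis_norm (m, n))"
      unfolding of_int_le_iff by (rule eis_norm_ge)
    then show ?thesis by simp
  qed
qed

lemma summable_eis_shift:
  assumes "0 < q" "q < 1" shows "(\<lambda>z. q powr (eis_shift z + 1/3)) summable_on A"
proof (rule summable_on_eis[OF assms, where c = 1])
  show "(real_of_int \<bar>m\<bar> + real_of_int \<bar>n\<bar>) / 2 - 1 \<le> real_of_int (eis_shift (m, n)) + 1/3" for m n
  proof -
    have "real_of_int (\<bar>m\<bar> + \<bar>n\<bar> - 1) \<le> real_of_int (2 * eis_shift (m, n))"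
      unfolding of_int_le_iff by (rule eis_shift_ge)
    then show ?thesis by (simp add: field_simps)
  qed
qed

section \<open>Sums over residue classes modulo \<lambda>\<close>

lemma eis_classI: "m - n = 3 * k + i \<Longrightarrow> i \<in> {0, 1, 2} \<Longrightarrow> eis_class (m, n) = i"
  by (auto simp: eis_class_def)

lemma eis_classE:
  assumes "eis_class z = i"
  obtains k n where "z = (n + 3 * k + i, n)"
proof -
  obtain m n where z: "z = (m, n)" by (cases z)
  have "m = n + 3 * ((m - n) div 3) + i"
    using assms mult_div_mod_eq[of 3 "m - n"] unfolding z eis_class_def by simp
  then show ?thesis using that z by blast
qed

lemma eis_class_cases: "eis_class z = 0 \<or> eis_class z = 1 \<or> eis_class z = 2"
  unfolding eis_class_def by (cases z) auto

text \<open>With constant weight 1 this splits a lattice sum into its classes; in sums over triples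
  the weight is an inner sum, which depends on the outer variable through its class only.\<close>

lemma has_sum_class_weighted:
  fixes f :: "int \<times> int \<Rightarrow> real"
  assumes "\<And>i. i \<in> {0, 1, 2} \<Longrightarrow> (f has_sum X i) {z. eis_class z = i}"
  shows "((\<lambda>z. f z * w (eis_class z)) has_sum (X 0 * w 0 + X 1 * w 1 + X 2 * w 2)) UNIV"
proof -
  have *: "((\<lambda>z. f z * w (eis_class z)) has_sum X i * w i) {z. eis_class z = i}" if "i \<in> {0, 1, 2}" for i
    using has_sum_cmult_left[OF assms[OF that], of "w i"] by (rule has_sum_cong[THEN iffD1, rotated]) auto
  have "(UNIV :: (int \<times> int) set) = {z. eis_class z = 0} \<union> {z. eis_class z = 1} \<union> {z. eis_class z = 2}"
    using eis_class_cases by auto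
  then show ?thesis
    using has_sum_Un_disjoint[OF has_sum_Un_disjoint[OF *[of 0] *[of 1]] *[of 2]]
    by (simp add: disjoint_iff)
qed

text \<open>The value at \<open>j\<close> of the threefold convolution of \<open>X\<close> with
  itself on the residues modulo 3.\<close>

definition class_sum3 :: "(int \<Rightarrow> real) \<Rightarrow> int \<Rightarrow> real" where
  "class_sum3 X j = (\<Sum>i\<in>{0, 1, 2}. \<Sum>k\<in>{0, 1, 2}. X i * X k * X ((j - i - k) mod 3))"

text \<open>The classes of two entries fix that of the third, so the constrained triples form a
  dependent product that can be summed from the inside out.\<close>

lemma has_sum_class_triples:
  fixes f :: "int \<times> int \<Rightarrow> real"
  assumes X: "\<And>i. i \<in> {0, 1, 2} \<Longrightarrow> (f has_sum X i) {z. eis_class z = i}"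
    and nonneg: "\<And>z. 0 \<le> f z"
  shows "((\<lambda>(x, y, z). f x * (f y * f z)) has_sum class_sum3 X j)
    (SIGMA x:UNIV. SIGMA y:UNIV. {z. eis_class z = (j - eis_class x - eis_class y) mod 3})"
proof -
  define V where "V i k = X ((j - i - k) mod 3)" for i k
  define W where "W i = X 0 * V i 0 + X 1 * V i 1 + X 2 * V i 2" for i
  have mod3: "n mod 3 \<in> {0, 1, 2}" for n :: int by auto
  have inner: "((\<lambda>(y, z). f y * f z) has_sum W (eis_class x))
      (SIGMA y:UNIV. {z. eis_class z = (j - eis_class x - eis_class y) mod 3})" for x
  proof (rule has_sum_Sigma_nonneg[where g = "\<lambda>y. f y * V (eis_class x) (eis_class y)"])
    show "((\<lambda>y. f y * V (eis_class x) (eis_class y)) has_sum W (eis_class x)) UNIV"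
      unfolding W_def by (rule has_sum_class_weighted[OF X])
    show "((\<lambda>z. case (y, z) of (y, z) \<Rightarrow> f y * f z) has_sum f y * V (eis_class x) (eis_class y))
        {z. eis_class z = (j - eis_class x - eis_class y) mod 3}" for y
      unfolding V_def by (auto intro!: has_sum_cmult_right X mod3 simp del: insert_iff)
  qed (auto simp: nonneg)
  have "((\<lambda>(x, y, z). f x * (f y * f z)) has_sum (X 0 * W 0 + X 1 * W 1 + X 2 * W 2))
    (SIGMA x:UNIV. SIGMA y:UNIV. {z. eis_class z = (j - eis_class x - eis_class y) mod 3})"
  proof (rule has_sum_Sigma_nonneg[where g = "\<lambda>x. f x * W (eis_class x)"])
    show "((\<lambda>x. f x * W (eis_class x)) has_sum (X 0 * W 0 + X 1 * W 1 + X 2 * W 2)) UNIV"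
      by (rule has_sum_class_weighted[OF X])
    show "((\<lambda>y. case (x, y) of (x, y, z) \<Rightarrow> f x * (f y * f z)) has_sum f x * W (eis_class x))
        (SIGMA y:UNIV. {z. eis_class z = (j - eis_class x - eis_class y) mod 3})" for x
      using has_sum_cmult_right[OF inner[of x], of "f x"] by (simp add: case_prod_unfold)
  qed (auto simp: nonneg)
  moreover have "X 0 * W 0 + X 1 * W 1 + X 2 * W 2 = class_sum3 X j"
    by (simp add: class_sum3_def W_def V_def algebra_simps)
  ultimately show ?thesis by simp
qed

section \<open>Relations between the theta functions at \<open>q\<close> and at
  \<open>q ^ 3\<close>\<close>

lemma powr_cube: "0 < q \<Longrightarrow> (q ^ 3) powr x = q powr (3 * x)" for q :: real
  by (simp add: powr_powr[symmetric])

text \<open>Multiplication by \<open>\<lambda>\<close> maps \<open>\<int>[\<omega>]\<close> onto the class \<open>0\<close> and its translate onto the class \<open>2\<close>.\<close>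

lemma infsum_eis_norm_class_0:
  assumes q: "0 < q"
  shows "(\<Sum>\<^sub>\<infinity>z | eis_class z = 0. q powr eis_norm z) = cubic_theta_a (q ^ 3)"
  unfolding cubic_theta_a_eq
\<comment> \<open>\<open>j\<close> is multiplication by \<lambda> and \<open>i\<close> division by
  it; both quotients by 3 are exact on class 0.\<close>
proof (rule sym, rule infsum_reindex_bij_witness[where j = "\<lambda>(m, n). (m - n, m + 2 * n)" and
      i = "\<lambda>(p, r). ((2 * p + r) div 3, (r - p) div 3)"])
  fix z :: "int \<times> int"
  obtain m n where z: "z = (m, n)" by (cases z)
  show "q powr eis_norm ((\<lambda>(m, n). (m - n, m + 2 * n)) z) = (q ^ 3) powr eis_norm z"
    using q by (simp add: z powr_cube eis_norm_def power2_eq_square algebra_simps)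
  show "(\<lambda>(p, r). ((2 * p + r) div 3, (r - p) div 3)) ((\<lambda>(m, n). (m - n, m + 2 * n)) z) = z"
    by (simp add: z)
  show "(\<lambda>(m, n). (m - n, m + 2 * n)) z \<in> {z. eis_class z = 0}"
    by (simp add: z eis_classI[where k = "- n"])
next
  fix z assume "z \<in> {z. eis_class z = 0}"
  then obtain k n where z: "z = (n + 3 * k, n)" by (auto elim: eis_classE)
  have div: "(2 * (n + 3 * k) + n) div 3 = n + 2 * k" "(n - (n + 3 * k)) div 3 = - k"
    by presburger+
  show "(\<lambda>(m, n). (m - n, m + 2 * n)) ((\<lambda>(p, r). ((2 * p + r) div 3, (r - p) div 3)) z) = z"
    unfolding z by (simp only: prod.case div) simp
qed auto

lemma infsum_eis_norm_class_2:
  assumes q: "0 < q"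
  shows "(\<Sum>\<^sub>\<infinity>z | eis_class z = 2. q powr eis_norm z) = cubic_theta_c (q ^ 3)"
  unfolding cubic_theta_c_eq
proof (rule sym, rule infsum_reindex_bij_witness[where j = "\<lambda>(m, n). (m - n, m + 2 * n + 1)" and
      i = "\<lambda>(p, r). ((2 * p + r - 1) div 3, (r - 1 - p) div 3)"])
  fix z :: "int \<times> int"
  obtain m n where z: "z = (m, n)" by (cases z)
  have "3 * (real_of_int (eis_shift z) + 1 / 3) = real_of_int (eis_norm (m - n, m + 2 * n + 1))"
    by (simp add: z eis_norm_def eis_shift_def power2_eq_square algebra_simps)
  then show "q powr eis_norm ((\<lambda>(m, n). (m - n, m + 2 * n + 1)) z) = (q ^ 3) powr (eis_shift z + 1/3)"
    using q by (simp add: z powr_cube)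
  show "(\<lambda>(p, r). ((2 * p + r - 1) div 3, (r - 1 - p) div 3)) ((\<lambda>(m, n). (m - n, m + 2 * n + 1)) z) = z"
    by (simp add: z)
  show "(\<lambda>(m, n). (m - n, m + 2 * n + 1)) z \<in> {z. eis_class z = 2}"
    by (simp add: z eis_classI[where k = "- n - 1"])
next
  fix z assume "z \<in> {z. eis_class z = 2}"
  then obtain k n where z: "z = (n + 3 * k + 2, n)" by (auto elim: eis_classE)
  have div: "(2 * (n + 3 * k + 2) + n - 1) div 3 = n + 2 * k + 1" "(n - 1 - (n + 3 * k + 2)) div 3 = - k - 1"
    by presburger+
  show "(\<lambda>(m, n). (m - n, m + 2 * n + 1)) ((\<lambda>(p, r). ((2 * p + r - 1) div 3, (r - 1 - p) div 3)) z) = z"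
    unfolding z by (simp only: prod.case div) simp
qed auto

text \<open>Negation preserves the norm and exchanges the classes 1 and 2.\<close>

lemma infsum_eis_norm_class_1:
  assumes q: "0 < q"
  shows "(\<Sum>\<^sub>\<infinity>z | eis_class z = 1. q powr eis_norm z) = cubic_theta_c (q ^ 3)"
  unfolding infsum_eis_norm_class_2[OF q, symmetric]
proof (rule infsum_reindex_bij_witness[where j = "\<lambda>(m, n). (- m, - n)" and i = "\<lambda>(m, n). (- m, - n)"])
  fix z assume "z \<in> {z. eis_class z = 1}"
  then obtain k n where z: "z = (n + 3 * k + 1, n)" by (auto elim: eis_classE)
  show "(\<lambda>(m, n). (- m, - n)) z \<in> {z. eis_class z = 2}"
    by (simp add: z eis_classI[where k = "- k - 1"])
next
  fix z assume "z \<in> {z. eis_class z = 2}"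
  then obtain k n where z: "z = (n + 3 * k + 2, n)" by (auto elim: eis_classE)
  show "(\<lambda>(m, n). (- m, - n)) z \<in> {z. eis_class z = 1}"
    by (simp add: z eis_classI[where k = "- k - 1"])
qed (auto simp: eis_norm_def)

text \<open>The class 0 contributes \<open>a(q^3)\<close>, each of the other two classes
  \<open>c(q^3)\<close>.\<close>

lemma cubic_theta_a_cube:
  assumes q: "0 < q" "q < 1"
  shows "cubic_theta_a q = cubic_theta_a (q ^ 3) + 2 * cubic_theta_c (q ^ 3)"
proof -
  define X where "X i = (\<Sum>\<^sub>\<infinity>z | eis_class z = i. q powr eis_norm z)" for i
  have "((\<lambda>z. q powr eis_norm z) has_sum X i) {z. eis_class z = i}" for i
    unfolding X_def by (intro has_sum_infsum summable_eis_norm q)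
  from has_sum_class_weighted[of _ X, OF this, of "\<lambda>_. 1"]
  have "((\<lambda>z. q powr eis_norm z) has_sum (X 0 + X 1 + X 2)) UNIV" by simp
  then show ?thesis
    using q by (simp add: cubic_theta_a_eq[of q] infsumI X_def infsum_eis_norm_class_0
      infsum_eis_norm_class_1 infsum_eis_norm_class_2)
qed

text \<open>Rotating the translate of the lattice by \<open>\<omega>\<close> permutes its three classes.\<close>

lemma infsum_eis_shift_class_Suc:
  assumes "i \<in> {0, 1}"
  shows "(\<Sum>\<^sub>\<infinity>z | eis_class z = i. q powr (eis_shift z + 1/3)) = (\<Sum>\<^sub>\<infinity>z | eis_class z = i + 1. q powr (eis_shift z + 1/3))"
proof (rule infsum_reindex_bij_witness[where j = "\<lambda>(m, n). (n, - m - 1 - n)" and i = "\<lambda>(p, r). (- r - 1 - p, p)"])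
  fix z assume "z \<in> {z. eis_class z = i}"
  then obtain k n where z: "z = (n + 3 * k + i, n)" using eis_classE[of z i] by (metis mem_Collect_eq)
  show "(\<lambda>(m, n). (n, - m - 1 - n)) z \<in> {z. eis_class z = i + 1}"
    using assms by (auto simp: z intro!: eis_classI[where k = "n + k"])
next
  fix z assume "z \<in> {z. eis_class z = i + 1}"
  then obtain k n where z: "z = (n + 3 * k + (i + 1), n)" using eis_classE[of z "i + 1"] by (metis mem_Collect_eq)
  show "(\<lambda>(p, r). (- r - 1 - p, p)) z \<in> {z. eis_class z = i}"
    using assms by (auto simp: z intro!: eis_classI[where k = "- n - 2 * k - 1 - i"])
qed (auto simp: eis_shift_def power2_eq_square algebra_simps)

lemma infsum_eis_shift_class:
  assumes q: "0 < q" "q < 1" and "i \<in> {0, 1, 2}"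
  shows "(\<Sum>\<^sub>\<infinity>z | eis_class z = i. q powr (eis_shift z + 1/3)) = cubic_theta_c q / 3"
proof -
  define X where "X i = (\<Sum>\<^sub>\<infinity>z | eis_class z = i. q powr (eis_shift z + 1/3))" for i
  have "((\<lambda>z. q powr (eis_shift z + 1/3)) has_sum X i) {z. eis_class z = i}" for i
    unfolding X_def by (intro has_sum_infsum summable_eis_shift q)
  from has_sum_class_weighted[of _ X, OF this, of "\<lambda>_. 1"]
  have "((\<lambda>z. q powr (eis_shift z + 1/3)) has_sum (X 0 + X 1 + X 2)) UNIV" by simp
  then have "cubic_theta_c q = X 0 + X 1 + X 2"
    by (simp add: cubic_theta_c_eq infsumI)
  moreover have "X 0 = X 1" "X 1 = X 2"
    using infsum_eis_shift_class_Suc[of 0 q] infsum_eis_shift_class_Suc[of 1 q] by (auto simp: X_def)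
  ultimately show ?thesis using assms(3) by (auto simp: X_def)
qed

text \<open>The unitary matrix \<open>1/\<lambda> (1, 1, 1; 1, \<omega>\<^sup>2, \<omega>; 1, \<omega>, \<omega>\<^sup>2)\<close> maps the triples in the translate of the
  lattice whose classes sum to \<open>0\<close> to the lattice triples whose classes sum to \<open>1\<close>. Both sets are
  parametrised by \<open>u\<^sub>1, u\<^sub>2, t \<in> \<int>[\<omega>]\<close>: as \<open>(u\<^sub>1, u\<^sub>2, \<lambda> t - u\<^sub>1 - u\<^sub>2)\<close> and, up to units, as
  \<open>(t + 1, t - u\<^sub>2 + \<omega>\<^sup>2 u\<^sub>1, t - u\<^sub>1 + \<omega>\<^sup>2 u\<^sub>2)\<close>.\<close>

lemma infsum_eis_triples:
  fixes q :: real
  assumes q: "0 < q"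
  defines "T \<equiv> \<lambda>j. SIGMA x:UNIV. SIGMA y:UNIV. {z. eis_class z = (j - eis_class x - eis_class y) mod 3}"
  shows "(\<Sum>\<^sub>\<infinity>(x, y, z)\<in>T 0. q powr (eis_shift x + 1/3) * (q powr (eis_shift y + 1/3) * q powr (eis_shift z + 1/3)))
    = (\<Sum>\<^sub>\<infinity>(x, y, z)\<in>T 1. q powr eis_norm x * (q powr eis_norm y * q powr eis_norm z))"
    (is "infsum ?g _ = infsum ?f _")
proof -
  \<comment> \<open>The pairs \<open>(a, b)\<close>, \<open>(c, d)\<close>, \<open>(e, f)\<close>
    are the coordinates of \<open>u\<^sub>1\<close>, \<open>u\<^sub>2\<close>, \<open>t\<close>.
    Here \<open>(e - f, e + 2 * f)\<close> is \<lambda>\<open>t\<close>, and \<omega>-squared sends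
    \<open>(a, b)\<close> to \<open>(- a - b, a)\<close>.\<close>
  define \<phi> :: "(int \<times> int) \<times> (int \<times> int) \<times> (int \<times> int) \<Rightarrow> (int \<times> int) \<times> (int \<times> int) \<times> (int \<times> int)"
    where "\<phi> = (\<lambda>((a, b), (c, d), (e, f)). ((a, b), (c, d), (e - f - a - c, e + 2 * f - b - d)))"
  define \<psi> :: "(int \<times> int) \<times> (int \<times> int) \<times> (int \<times> int) \<Rightarrow> (int \<times> int) \<times> (int \<times> int) \<times> (int \<times> int)"
    where "\<psi> = (\<lambda>((a, b), (c, d), (e, f)). ((e + 1, f), (e - c - a - b, f - d + a), (e - a - c - d, f - b + c)))"
  have T: "((a, b), (c, d), (p, r)) \<in> T j \<longleftrightarrow> 3 dvd (a - b) + (c - d) + (p - r) - j" for a b c d p r j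
  proof -
    have "((a, b), (c, d), (p, r)) \<in> T j \<longleftrightarrow> (p - r) mod 3 = (j - (a - b) - (c - d)) mod 3"
    proof -
      have "(j - (a - b) mod 3 - (c - d) mod 3) mod 3 = (j - (a - b) - (c - d)) mod 3"
        by (metis mod_diff_left_eq mod_diff_right_eq)
      then show ?thesis by (simp add: T_def eis_class_def)
    qed
    also have "\<dots> \<longleftrightarrow> 3 dvd (a - b) + (c - d) + (p - r) - j"
      by (simp add: mod_eq_dvd_iff algebra_simps)
    finally show ?thesis .
  qed
  have "bij_betw \<phi> UNIV (T 0)"
  proof (rule bij_betw_imageI)
    show "inj \<phi>" unfolding \<phi>_def by (auto simp: inj_on_def)
    show "range \<phi> = T 0"
    proof (intro equalityI subsetI)
      fix y assume "y \<in> range \<phi>"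
      then obtain a b c d e f where "y = ((a, b), (c, d), (e - f - a - c, e + 2 * f - b - d))"
        unfolding \<phi>_def by auto
      then show "y \<in> T 0" by (auto simp: T algebra_simps)
    next
      fix y assume y: "y \<in> T 0"
      obtain a b c d p r where y_eq: "y = ((a, b), (c, d), (p, r))"
        by (metis prod.exhaust)
      obtain k where "(a - b) + (c - d) + (p - r) = 3 * k"
        using y unfolding y_eq T dvd_def by auto
      \<comment> \<open>The last pair is the sum of the three entries divided by \<lambda>.\<close>
      then have "y = \<phi> ((a, b), (c, d), (r + b + d + 2 * k, - k))"
        by (simp add: y_eq \<phi>_def)
      then show "y \<in> range \<phi>" by blast
    qed
  qed
  then have "infsum ?g (T 0) = infsum (\<lambda>u. ?g (\<phi> u)) UNIV"
    by (rule infsum_reindex_bij_betw[symmetric])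
  moreover have "bij_betw \<psi> UNIV (T 1)"
  proof (rule bij_betw_imageI)
    show "inj \<psi>" unfolding \<psi>_def by (auto simp: inj_on_def)
    show "range \<psi> = T 1"
    proof (intro equalityI subsetI)
      fix y assume "y \<in> range \<psi>"
      then obtain a b c d e f where "y = ((e + 1, f), (e - c - a - b, f - d + a), (e - a - c - d, f - b + c))"
        unfolding \<psi>_def by auto
      then show "y \<in> T 1" by (auto simp: T algebra_simps)
    next
      fix y assume y: "y \<in> T 1"
      obtain p1 r1 p2 r2 p3 r3 where y_eq: "y = ((p1, r1), (p2, r2), (p3, r3))"
        by (metis prod.exhaust)
      obtain k where k: "(p1 - r1) + (p2 - r2) + (p3 - r3) - 1 = 3 * k"
        using y unfolding y_eq T dvd_def by auto
      \<comment> \<open>Inverting \<psi>: its first two entries determine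
        \<open>g = a + b + c\<close> and \<open>h = d - a\<close>. The third then determines
        \<open>3 * b\<close>, and the congruence with quotient \<open>k\<close> makes the division
        by 3 exact.\<close>
      define g where "g = p1 - 1 - p2"
      define h where "h = r1 - r2"
      define b where "b = k + r1 - p2"
      define a where "a = p1 - 1 - p3 - g - h + b"
      have "y = \<psi> ((a, b), (g - a - b, h + a), (p1 - 1, r1))"
        using k by (simp add: y_eq \<psi>_def a_def b_def g_def h_def)
      then show "y \<in> range \<psi>" by blast
    qed
  qed
  then have "infsum ?f (T 1) = infsum (\<lambda>u. ?f (\<psi> u)) UNIV"
    by (rule infsum_reindex_bij_betw[symmetric])
  moreover have "?g (\<phi> u) = ?f (\<psi> u)" for u
  proof -
    obtain a b c d e f where u: "u = ((a, b), (c, d), (e, f))" by (cases u) auto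
    show ?thesis unfolding u \<phi>_def \<psi>_def
      by (simp add: powr_add[symmetric] eis_shift_def eis_norm_def power2_eq_square algebra_simps)
  qed
  ultimately show ?thesis by simp
qed

text \<open>Compare the two sides of \<open>infsum_eis_triples\<close>. In the translate all nine
  admissible class patterns weigh the same, giving \<open>c(q)^3 / 3\<close>. In the lattice, class
  sum 1 arises from the patterns 0,0,1 and 0,2,2 and 1,1,2, each in three orders.\<close>

lemma cubic_theta_c_cubed:
  assumes q: "0 < q" "q < 1"
  defines "A \<equiv> cubic_theta_a (q ^ 3)" and "C \<equiv> cubic_theta_c (q ^ 3)"
  shows "cubic_theta_c q ^ 3 = 9 * C * (A\<^sup>2 + A * C + C\<^sup>2)"
proof -
  define X where "X i = (if i = 0 then A else C)" for i :: int
  have X: "((\<lambda>z. q powr eis_norm z) has_sum X i) {z. eis_class z = i}" if "i \<in> {0, 1, 2}" for i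
  proof -
    have "X i = (\<Sum>\<^sub>\<infinity>z | eis_class z = i. q powr eis_norm z)"
      using that q by (auto simp: X_def A_def C_def infsum_eis_norm_class_0 infsum_eis_norm_class_1 infsum_eis_norm_class_2)
    then show ?thesis using summable_eis_norm[OF q] by (metis has_sum_infsum)
  qed
  have Y: "((\<lambda>z. q powr (eis_shift z + 1/3)) has_sum cubic_theta_c q / 3) {z. eis_class z = i}"
    if "i \<in> {0, 1, 2}" for i
    using infsum_eis_shift_class[OF q that] summable_eis_shift[OF q] by (metis has_sum_infsum)
  have "class_sum3 (\<lambda>_. cubic_theta_c q / 3) 0 = class_sum3 X 1"
    using infsum_eis_triples[OF q(1)] infsumI[OF has_sum_class_triples[OF Y, of 0]]
      infsumI[OF has_sum_class_triples[OF X, of 1]] by simp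
  moreover have "class_sum3 X 1 = 3 * C * (A\<^sup>2 + A * C + C\<^sup>2)"
    by (simp add: class_sum3_def X_def power2_eq_square algebra_simps)
  moreover have "class_sum3 (\<lambda>_. cubic_theta_c q / 3) 0 = cubic_theta_c q ^ 3 / 3"
    by (simp add: class_sum3_def power3_eq_cube)
  ultimately show ?thesis by simp
qed

section \<open>The cubic modulus as a function of the nome\<close>

lemma cubic_theta_a_ge_1:
  assumes "0 < q" "q < 1" shows "1 \<le> cubic_theta_a q"
proof -
  have "(\<Sum>\<^sub>\<infinity>z\<in>{(0, 0)}. q powr eis_norm z) \<le> cubic_theta_a q"
    unfolding cubic_theta_a_eq by (intro infsum_mono2 summable_eis_norm assms) auto
  then show ?thesis using assms by (simp add: eis_norm_def)
qed

lemma cubic_theta_a_mono: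
  assumes "0 < q" "q \<le> p" "p < 1" shows "cubic_theta_a q \<le> cubic_theta_a p"
  unfolding cubic_theta_a_eq
  by (intro infsum_mono summable_eis_norm powr_mono2) (use assms eis_norm_nonneg in auto)

lemma cubic_theta_c_ge:
  assumes "0 < q" "q < 1" shows "q powr (1/3) \<le> cubic_theta_c q"
proof -
  have "(\<Sum>\<^sub>\<infinity>z\<in>{(0, 0)}. q powr (eis_shift z + 1/3)) \<le> cubic_theta_c q"
    unfolding cubic_theta_c_eq by (intro infsum_mono2 summable_eis_shift assms) auto
  then show ?thesis using assms by (simp add: eis_shift_def)
qed

lemma cubic_theta_c_pos:
  assumes "0 < q" "q < 1" shows "0 < cubic_theta_c q"
  using cubic_theta_c_ge[OF assms] assms by (smt (verit) powr_gt_zero)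

text \<open>\<open>c(q) / q^(1/3)\<close> is increasing, because \<open>eis_shift\<close> is
  nonnegative.\<close>

lemma cubic_theta_c_le:
  assumes "0 < q" "q \<le> p" "p < 1"
  shows "cubic_theta_c q \<le> (q / p) powr (1/3) * cubic_theta_c p"
proof -
  have "cubic_theta_c q \<le> (\<Sum>\<^sub>\<infinity>z. (q / p) powr (1/3) * p powr (eis_shift z + 1/3))"
    unfolding cubic_theta_c_eq
  proof (intro infsum_mono summable_on_cmult_right summable_eis_shift)
    fix z
    have "(q / p) powr (eis_shift z + 1/3) \<le> (q / p) powr (1/3)"
      using assms eis_shift_nonneg[of z] by (intro powr_mono') auto
    then have "(q / p) powr (eis_shift z + 1/3) * p powr (eis_shift z + 1/3) \<le> (q / p) powr (1/3) * p powr (eis_shift z + 1/3)"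
      by (intro mult_right_mono) auto
    then show "q powr (eis_shift z + 1/3) \<le> (q / p) powr (1/3) * p powr (eis_shift z + 1/3)"
      using assms by (simp add: powr_divide)
  qed (use assms in auto)
  then show ?thesis unfolding cubic_theta_c_eq[of p] infsum_cmult_right' .
qed

lemma cube_powr_third:
  fixes q :: real
  assumes "0 < q" shows "(q powr (1/3)) ^ 3 = q"
  using assms by (simp add: powr_power)

definition theta_mod :: "real \<Rightarrow> real" where
  "theta_mod q = (cubic_theta_c q / cubic_theta_a q) ^ 3"

text \<open>The constants depend on \<open>p\<close> only, so they serve for every
  \<open>q ^ 3 ^ n\<close> at once.\<close>

lemma theta_mod_bounds:
  assumes q: "0 < q" "q \<le> p" "p < 1"
  shows "q / cubic_theta_a p ^ 3 \<le> theta_mod q" "theta_mod q \<le> q * (cubic_theta_c p ^ 3 / p)"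
proof -
  have a: "1 \<le> cubic_theta_a q" "cubic_theta_a q \<le> cubic_theta_a p"
    using q cubic_theta_a_ge_1 cubic_theta_a_mono by auto
  have c: "q powr (1/3) \<le> cubic_theta_c q" "cubic_theta_c q \<le> (q / p) powr (1/3) * cubic_theta_c p"
    using q cubic_theta_c_ge cubic_theta_c_le by auto
  have "q / cubic_theta_a p ^ 3 = (q powr (1/3)) ^ 3 / cubic_theta_a p ^ 3"
    using q by (simp add: cube_powr_third)
  also have "\<dots> \<le> cubic_theta_c q ^ 3 / cubic_theta_a q ^ 3"
    using a c(1) by (intro frac_le power_mono) (auto intro: order_trans[OF powr_ge_zero])
  finally show "q / cubic_theta_a p ^ 3 \<le> theta_mod q" by (simp add: theta_mod_def power_divide)
  have "theta_mod q \<le> cubic_theta_c q ^ 3 / 1"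
    unfolding theta_mod_def power_divide using a c(1)
    by (intro frac_le) (auto intro: order_trans[OF powr_ge_zero])
  also have "\<dots> \<le> ((q / p) powr (1/3) * cubic_theta_c p) ^ 3 / 1"
    using c by (intro divide_right_mono power_mono) (auto intro: order_trans[OF powr_ge_zero])
  also have "\<dots> = q * (cubic_theta_c p ^ 3 / p)"
    using q cube_powr_third[of "q / p"] by (simp add: power_mult_distrib)
  finally show "theta_mod q \<le> q * (cubic_theta_c p ^ 3 / p)" .
qed

text \<open>This is the Borwein identity \<open>a^3 = b^3 + c^3\<close>, with the third theta
  function in the form \<open>b(q) = a(q^3) - c(q^3)\<close>.\<close>

lemma cubic_theta_diff_cubes:
  assumes "0 < q" "q < 1"
  shows "cubic_theta_a q ^ 3 - cubic_theta_c q ^ 3 = (cubic_theta_a (q ^ 3) - cubic_theta_c (q ^ 3)) ^ 3"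
  unfolding cubic_theta_c_cubed[OF assms] cubic_theta_a_cube[OF assms] by algebra

section \<open>Iterating \<open>q \<mapsto> q ^ 3\<close>\<close>

lemma power_3_power_tendsto_0:
  fixes q :: real
  assumes "0 < q" "q < 1" shows "(\<lambda>n. q ^ 3 ^ n) \<longlonglongrightarrow> 0"
proof -
  have "strict_mono (\<lambda>n. 3 ^ n :: nat)" by (auto simp: strict_mono_def)
  then show ?thesis
    using LIMSEQ_subseq_LIMSEQ[OF LIMSEQ_realpow_zero[of q]] assms by (auto simp: o_def)
qed

lemma power_3_power_bounds:
  fixes q :: real
  assumes "0 < q" "q < 1" shows "0 < q ^ 3 ^ n" "q ^ 3 ^ n \<le> q" "q ^ 3 ^ n < 1"
proof -
  show "q ^ 3 ^ n \<le> q" using assms power_decreasing[of 1 "3 ^ n" q] by simp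
  then show "q ^ 3 ^ n < 1" using assms by simp
qed (use assms in auto)

lemma theta_mod_tendsto_0:
  assumes q: "0 < q" "q < 1" shows "(\<lambda>n. theta_mod (q ^ 3 ^ n)) \<longlonglongrightarrow> 0"
proof (rule tendsto_sandwich)
  show "\<forall>\<^sub>F n in sequentially. 0 \<le> theta_mod (q ^ 3 ^ n)"
    using power_3_power_bounds[OF q] cubic_theta_a_ge_1 cubic_theta_c_pos
    by (intro always_eventually allI) (smt (verit) divide_nonneg_nonneg theta_mod_def zero_le_power)
  show "\<forall>\<^sub>F n in sequentially. theta_mod (q ^ 3 ^ n) \<le> q ^ 3 ^ n * (cubic_theta_c q ^ 3 / q)"
    using theta_mod_bounds(2) power_3_power_bounds[OF q] q by (intro always_eventually allI) blast
  show "(\<lambda>n. q ^ 3 ^ n * (cubic_theta_c q ^ 3 / q)) \<longlonglongrightarrow> 0"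
    by (rule tendsto_mult_left_zero[OF power_3_power_tendsto_0[OF q]])
qed simp

lemma theta_mod_less_1_iff:
  assumes "0 < q" "q < 1"
  shows "theta_mod q < 1 \<longleftrightarrow> cubic_theta_c q < cubic_theta_a q"
proof -
  have "0 < cubic_theta_a q" "0 < cubic_theta_c q"
    using cubic_theta_a_ge_1[OF assms] cubic_theta_c_pos[OF assms] by auto
  then show ?thesis by (simp add: theta_mod_def power_less_one_iff)
qed

text \<open>By \<open>cubic_theta_diff_cubes\<close> the inequality \<open>c < a\<close> holds at \<open>q\<close> iff it holds at \<open>q\<^sup>3\<close>.\<close>
lemma cubic_theta_c_less_a:
  assumes q: "0 < q" "q < 1" shows "cubic_theta_c q < cubic_theta_a q"
proof -
  have step: "cubic_theta_c (q ^ 3) < cubic_theta_a (q ^ 3) \<longleftrightarrow> cubic_theta_c q < cubic_theta_a q"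
    if q: "0 < q" "q < 1" for q
  proof -
    have "cubic_theta_c (q ^ 3) < cubic_theta_a (q ^ 3) \<longleftrightarrow> 0 < (cubic_theta_a (q ^ 3) - cubic_theta_c (q ^ 3)) ^ 3"
      by (simp add: zero_less_power_eq)
    also have "\<dots> \<longleftrightarrow> cubic_theta_c q ^ 3 < cubic_theta_a q ^ 3"
      unfolding cubic_theta_diff_cubes[OF q, symmetric] by simp
    also have "\<dots> \<longleftrightarrow> cubic_theta_c q < cubic_theta_a q"
      using power_strict_mono[of "cubic_theta_c q" "cubic_theta_a q" 3]
        power_less_imp_less_base[of "cubic_theta_c q" 3 "cubic_theta_a q"]
        cubic_theta_a_ge_1[OF q] cubic_theta_c_pos[OF q] by auto
    finally show ?thesis .
  qed
  have iter: "cubic_theta_c (q ^ 3 ^ n) < cubic_theta_a (q ^ 3 ^ n) \<longleftrightarrow> cubic_theta_c q < cubic_theta_a q" for n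
  proof (induction n)
    case (Suc n)
    then show ?case using step[OF power_3_power_bounds(1,3)[OF q, of n]]
      by (simp add: power_mult[symmetric] mult.commute)
  qed simp
  have "\<forall>\<^sub>F n in sequentially. theta_mod (q ^ 3 ^ n) < 1"
    using theta_mod_tendsto_0[OF q] by (rule order_tendstoD) simp
  then obtain n where "theta_mod (q ^ 3 ^ n) < 1"
    by (auto simp: eventually_sequentially)
  then show ?thesis
    using iter theta_mod_less_1_iff[OF power_3_power_bounds(1,3)[OF q]] by blast
qed

lemma theta_mod_01:
  assumes "0 < q" "q < 1" shows "0 < theta_mod q" "theta_mod q < 1"
  using theta_mod_less_1_iff[OF assms] cubic_theta_c_less_a[OF assms] cubic_theta_a_ge_1[OF assms]
    cubic_theta_c_pos[OF assms] by (auto simp: theta_mod_def)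

text \<open>The involution \<open>t \<mapsto> (1 - t) / (1 + 2 t)\<close> exchanges
  \<open>x = b(q) / a(q)\<close>, where \<open>b(q) = A - C\<close>, and
  \<open>y = c(q^3) / a(q^3)\<close>. The cubic transformation at \<open>x\<close> and at
  \<open>y\<close> relates numerators and denominators of the two ratios; since
  \<open>(1 + 2 x) (1 + 2 y) = 3\<close>, the factor left over is \<open>9 / 3\<close>.\<close>

lemma hgF_ratio_theta_mod_cube:
  assumes q: "0 < q" "q < 1"
  shows "hgF (1/3) (1 - theta_mod (q ^ 3)) / hgF (1/3) (theta_mod (q ^ 3)) =
    3 * (hgF (1/3) (1 - theta_mod q) / hgF (1/3) (theta_mod q))"
proof -
  define A where "A = cubic_theta_a (q ^ 3)"
  define C where "C = cubic_theta_c (q ^ 3)"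
  define x where "x = (A - C) / (A + 2 * C)"
  define y where "y = C / A"
  have q3: "0 < q ^ 3" "q ^ 3 < 1" using q by (auto simp: power_less_one_iff)
  have AC: "0 < C" "C < A" "0 < A"
    using cubic_theta_c_pos[OF q3] cubic_theta_c_less_a[OF q3] by (auto simp: A_def C_def)
  have x: "0 < x" "x < 1" and y: "0 < y" "y < 1"
    using AC by (auto simp: x_def y_def)
  have xy: "(1 - x) / (1 + 2 * x) = y" "(1 - y) / (1 + 2 * y) = x" "(1 + 2 * x) * (1 + 2 * y) = 3"
    using AC by (auto simp: x_def y_def divide_simps)
  have "x ^ 3 = 1 - theta_mod q"
  proof -
    have "x ^ 3 = (cubic_theta_a q ^ 3 - cubic_theta_c q ^ 3) / cubic_theta_a q ^ 3"
      unfolding cubic_theta_diff_cubes[OF q] unfolding cubic_theta_a_cube[OF q]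
      by (simp add: x_def A_def C_def power_divide)
    then show ?thesis
      using cubic_theta_a_ge_1[OF q] by (simp add: theta_mod_def diff_divide_distrib power_divide)
  qed
  moreover have "y ^ 3 = theta_mod (q ^ 3)" by (simp add: y_def A_def C_def theta_mod_def)
  ultimately have 1: "3 * hgF (1/3) (theta_mod (q ^ 3)) = (1 + 2 * x) * hgF (1/3) (theta_mod q)"
    and 2: "3 * hgF (1/3) (1 - theta_mod q) = (1 + 2 * y) * hgF (1/3) (1 - theta_mod (q ^ 3))"
    using hgF_cubic_transformation[OF x] hgF_cubic_transformation[OF y] unfolding xy by auto
  have pos: "0 < hgF (1/3) (theta_mod q)" "0 < hgF (1/3) (theta_mod (q ^ 3))"
    using hgF_ge_1[of "1/3" "theta_mod q"] hgF_ge_1[of "1/3" "theta_mod (q ^ 3)"]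
      theta_mod_01[OF q] theta_mod_01[OF q3] by auto
  have "hgF (1/3) (1 - theta_mod (q ^ 3)) * hgF (1/3) (theta_mod q) * ((1 + 2 * x) * (1 + 2 * y)) =
     ((1 + 2 * y) * hgF (1/3) (1 - theta_mod (q ^ 3))) * ((1 + 2 * x) * hgF (1/3) (theta_mod q))"
    by (simp only: mult_ac)
  also have "\<dots> = 9 * (hgF (1/3) (1 - theta_mod q) * hgF (1/3) (theta_mod (q ^ 3)))"
    unfolding 1[symmetric] 2[symmetric] by simp
  finally have "hgF (1/3) (1 - theta_mod (q ^ 3)) * hgF (1/3) (theta_mod q) =
      3 * (hgF (1/3) (1 - theta_mod q) * hgF (1/3) (theta_mod (q ^ 3)))"
    unfolding xy(3) by (simp add: mult_ac)
  then have "hgF (1/3) (1 - theta_mod (q ^ 3)) / hgF (1/3) (theta_mod (q ^ 3)) =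
      (3 * hgF (1/3) (1 - theta_mod q)) / hgF (1/3) (theta_mod q)"
    using pos by (subst frac_eq_eq) (auto simp: mult_ac)
  then show ?thesis by simp
qed

lemma hgF_ratio_theta_mod:
  assumes q: "0 < q" "q < 1"
  shows "hgF (1/3) (1 - theta_mod q) / hgF (1/3) (theta_mod q) = - (sqrt 3 / (2 * pi)) * ln q"
proof -
  define h where "h q = hgF (1/3) (1 - theta_mod q) / hgF (1/3) (theta_mod q)" for q
  define \<alpha> where "\<alpha> n = theta_mod (q ^ 3 ^ n)" for n
  note qn = power_3_power_bounds[OF q]
  have \<alpha>: "0 < \<alpha> n" "\<alpha> n < 1" for n
    unfolding \<alpha>_def by (intro theta_mod_01 qn)+
  have iter: "h (q ^ 3 ^ n) = 3 ^ n * h q" for n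
  proof (induction n)
    case (Suc n)
    have "q ^ 3 ^ Suc n = (q ^ 3 ^ n) ^ 3" by (simp add: power_mult[symmetric] mult.commute)
    then show ?case
      using hgF_ratio_theta_mod_cube[OF qn(1,3)[of n]] Suc by (simp add: h_def)
  qed simp
  have \<alpha>0: "\<alpha> \<longlonglongrightarrow> 0" unfolding \<alpha>_def by (rule theta_mod_tendsto_0[OF q])
  have "filterlim \<alpha> (at_right 0) sequentially"
    by (rule tendsto_imp_filterlim_at_right[OF \<alpha>0]) (simp add: \<alpha>(1))
  from filterlim_compose[OF hgF_log_asymp[of "1/3"] this]
  have lim1: "(\<lambda>n. hgF (1/3) (1 - \<alpha> n) / (- ln (\<alpha> n))) \<longlonglongrightarrow> sqrt 3 / (2 * pi)"
    by (simp add: sin_60)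
  have lim2: "(\<lambda>n. hgF (1/3) (\<alpha> n)) \<longlonglongrightarrow> 1"
    using isCont_tendsto_compose[OF DERIV_isCont[OF hgF_deriv0[of "1/3" 0]] \<alpha>0] by simp
  \<comment> \<open>\<open>\<alpha> n\<close> lies between constant multiples of
    \<open>q ^ 3 ^ n\<close>, so its logarithm is \<open>3 ^ n * ln q\<close> up to a bounded
    error.\<close>
  have lim3: "(\<lambda>n. ln (\<alpha> n) / 3 ^ n) \<longlonglongrightarrow> ln q"
  proof -
    define K1 where "K1 = 1 / cubic_theta_a q ^ 3"
    define K2 where "K2 = cubic_theta_c q ^ 3 / q"
    have K: "0 < K1" "0 < K2"
      using cubic_theta_a_ge_1[OF q] cubic_theta_c_pos[OF q] q by (auto simp: K1_def K2_def)
    have b: "q ^ 3 ^ n * K1 \<le> \<alpha> n" "\<alpha> n \<le> q ^ 3 ^ n * K2" for n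
      using theta_mod_bounds[OF qn(1,2)[of n] q(2)] by (auto simp: K1_def K2_def \<alpha>_def)
    have lnq: "ln (q ^ 3 ^ n * K) / 3 ^ n = ln q + ln K / 3 ^ n" if "0 < K" for n K
      using that q by (simp add: ln_mult ln_realpow add_divide_distrib)
    have lim: "(\<lambda>n. ln q + ln K / 3 ^ n) \<longlonglongrightarrow> ln q" for K :: real
    proof -
      have "(\<lambda>n. ln K * (1 / 3) ^ n) \<longlonglongrightarrow> ln K * 0"
        by (intro tendsto_intros LIMSEQ_realpow_zero) auto
      then have "(\<lambda>n. ln q + ln K * (1 / 3) ^ n) \<longlonglongrightarrow> ln q + ln K * 0"
        by (intro tendsto_add tendsto_const)
      then show ?thesis by (simp add: power_one_over)
    qed
    show ?thesis
    proof (rule tendsto_sandwich[OF _ _ lim[of K1] lim[of K2]])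
      have "ln (q ^ 3 ^ n * K1) \<le> ln (\<alpha> n)" "ln (\<alpha> n) \<le> ln (q ^ 3 ^ n * K2)" for n
        using b[of n] \<alpha>[of n] K qn(1)[of n] by auto
      then have "ln q + ln K1 / 3 ^ n \<le> ln (\<alpha> n) / 3 ^ n" "ln (\<alpha> n) / 3 ^ n \<le> ln q + ln K2 / 3 ^ n" for n
        unfolding lnq[OF K(1), symmetric] lnq[OF K(2), symmetric] by (auto intro: divide_right_mono)
      then show "\<forall>\<^sub>F n in sequentially. ln q + ln K1 / 3 ^ n \<le> ln (\<alpha> n) / 3 ^ n"
        "\<forall>\<^sub>F n in sequentially. ln (\<alpha> n) / 3 ^ n \<le> ln q + ln K2 / 3 ^ n"
        by auto
    qed
  qed
  have "(\<lambda>n. hgF (1/3) (1 - \<alpha> n) / (- ln (\<alpha> n)) * - (ln (\<alpha> n) / 3 ^ n) / hgF (1/3) (\<alpha> n))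
      \<longlonglongrightarrow> sqrt 3 / (2 * pi) * - ln q / 1"
    by (intro tendsto_intros lim1 lim2 lim3) auto
  \<comment> \<open>The logarithms cancel and \<open>iter\<close> removes the power of 3: the
    sequence whose limit was computed is constant.\<close>
  moreover have "hgF (1/3) (1 - \<alpha> n) / (- ln (\<alpha> n)) * - (ln (\<alpha> n) / 3 ^ n) / hgF (1/3) (\<alpha> n) = h q" for n
  proof -
    have "ln (\<alpha> n) \<noteq> 0" using \<alpha>[of n] by simp
    then have "hgF (1/3) (1 - \<alpha> n) / (- ln (\<alpha> n)) * - (ln (\<alpha> n) / 3 ^ n) / hgF (1/3) (\<alpha> n) = h (q ^ 3 ^ n) / 3 ^ n"
      by (simp add: h_def \<alpha>_def)
    then show ?thesis by (simp add: iter)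
  qed
  ultimately have "(\<lambda>n. h q) \<longlonglongrightarrow> - (sqrt 3 / (2 * pi)) * ln q" by simp
  then show ?thesis by (simp add: LIMSEQ_const_iff h_def)
qed

section \<open>From the nome to the singular moduli\<close>

lemma cubic_singular_modulus_eq:
  assumes "0 < r" shows "cubic_singular_modulus (3 * r) = theta_mod (exp (- 2 * pi * sqrt r))"
proof -
  \<comment> \<open>The \<open>sqrt 3\<close> from the index \<open>3 * r\<close> cancels the one in
    the exponent \<open>2 / sqrt 3\<close>.\<close>
  have "exp (- pi * sqrt (3 * r)) powr (2 / sqrt 3) = exp (- 2 * pi * sqrt r)"
    by (simp add: powr_def real_sqrt_mult)
  then show ?thesis by (simp add: cubic_singular_modulus_def theta_mod_def Let_def)
qed

theorem theorem4:
  fixes r :: real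
  assumes "r > 0"
  shows "beta_mod r =
    1 / 2 - (1 - 20 * cubic_singular_modulus (3 * r) - 8 * (cubic_singular_modulus (3 * r)) ^ 2)
            / (2 * (1 + 8 * cubic_singular_modulus (3 * r)) powr (3 / 2))"
proof -
  define \<alpha> where "\<alpha> = cubic_singular_modulus (3 * r)"
  define q where "q = exp (- 2 * pi * sqrt r)"
  have q: "0 < q" "q < 1" using assms by (auto simp: q_def)
  have \<alpha>_eq: "\<alpha> = theta_mod q"
    using cubic_singular_modulus_eq[OF assms] by (simp add: \<alpha>_def q_def)
  have \<alpha>: "0 < \<alpha>" "\<alpha> < 1" using theta_mod_01[OF q] by (auto simp: \<alpha>_eq)
  have ratio3: "hgF (1/3) (1 - \<alpha>) / hgF (1/3) \<alpha> = sqrt 3 * sqrt r"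
    unfolding \<alpha>_eq hgF_ratio_theta_mod[OF q] by (simp add: q_def)
  define s where "s = sqrt (1 + 8 * \<alpha>)"
  have s2: "s\<^sup>2 = 1 + 8 * \<alpha>" using \<alpha> by (simp add: s_def)
  have s: "1 < s" "s < 3"
    unfolding s_def using \<alpha> by (auto intro: real_less_rsqrt real_less_lsqrt)
  have \<alpha>_s: "\<alpha> = (s\<^sup>2 - 1) / 8" by (simp add: s2)
  define \<beta> where "\<beta> = (s - 1) * (s + 3) ^ 3 / (16 * s ^ 3)"
  have one_\<beta>: "1 - \<beta> = (s + 1) * (3 - s) ^ 3 / (16 * s ^ 3)"
  proof -
    have "16 * s ^ 3 - (s - 1) * (s + 3) ^ 3 = (s + 1) * (3 - s) ^ 3" by algebra
    then show ?thesis using s by (simp add: \<beta>_def diff_divide_eq_iff)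
  qed
  have "0 < \<beta>" using s by (simp add: \<beta>_def)
  moreover have "0 < 1 - \<beta>" unfolding one_\<beta> using s by simp
  ultimately have \<beta>: "0 < \<beta>" "\<beta> < 1" by auto
  have "hgF (1/6) \<beta> = sqrt s * hgF (1/3) \<alpha>" "sqrt 3 * hgF (1/6) (1 - \<beta>) = sqrt s * hgF (1/3) (1 - \<alpha>)"
    using hgF_sextic_cubic[OF s] unfolding \<beta>_def[symmetric] \<alpha>_s[symmetric] .
  \<comment> \<open>The common factor \<open>sqrt s\<close> drops out of the quotient, and the
    \<open>sqrt 3\<close> on the left will cancel against the one in \<open>ratio3\<close>.\<close>
  then have "sqrt 3 * (hgF (1/6) (1 - \<beta>) / hgF (1/6) \<beta>) = hgF (1/3) (1 - \<alpha>) / hgF (1/3) \<alpha>"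
    using s by simp
  then have ratio6: "hgF (1/6) (1 - \<beta>) / hgF (1/6) \<beta> = sqrt r"
    unfolding ratio3 by (simp only: mult_cancel_left) simp
  have "beta_mod r = \<beta>"
    unfolding beta_mod_def
  proof (rule the_equality)
    have hyp: "hyp2F1 (1/6) (5/6) 1 = hgF (1/6)"
      using hyp2F1_eq_hgF[of "1/6"] by (simp add: fun_eq_iff)
    show "0 < \<beta> \<and> \<beta> < 1 \<and> hyp2F1 (1/6) (5/6) 1 (1 - \<beta>) / hyp2F1 (1/6) (5/6) 1 \<beta> = sqrt r"
      using \<beta> ratio6 by (simp add: hyp)
    show "x = \<beta>" if "0 < x \<and> x < 1 \<and> hyp2F1 (1/6) (5/6) 1 (1 - x) / hyp2F1 (1/6) (5/6) 1 x = sqrt r" for x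
    proof (rule hgF_ratio_inj)
      show "hgF (1/6) (1 - x) / hgF (1/6) x = hgF (1/6) (1 - \<beta>) / hgF (1/6) \<beta>"
        unfolding ratio6 using that by (simp only: hyp)
    qed (use that \<beta> in auto)
  qed
  \<comment> \<open>In the expanded numerator of \<beta> the only odd power is
    \<open>8 * s ^ 3\<close>, which yields the \<open>1/2\<close>; the even powers form a polynomial
    in \<open>s^2\<close>, hence in \<alpha>.\<close>
  also have "\<beta> = 1/2 - (1 - 20 * \<alpha> - 8 * \<alpha>\<^sup>2) / (2 * s ^ 3)"
  proof -
    have "8 * (1 - 20 * \<alpha> - 8 * \<alpha>\<^sup>2) = 27 - 18 * s\<^sup>2 - s ^ 4"
      unfolding \<alpha>_s by (simp add: field_simps power4_eq_xxxx power2_eq_square)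
    then have "1 - 20 * \<alpha> - 8 * \<alpha>\<^sup>2 = (27 - 18 * s\<^sup>2 - s ^ 4) / 8" by simp
    moreover have "(s - 1) * (s + 3) ^ 3 = 8 * s ^ 3 - (27 - 18 * s\<^sup>2 - s ^ 4)" by algebra
    ultimately show ?thesis using s by (simp add: \<beta>_def diff_divide_distrib)
  qed
  also have "s ^ 3 = (1 + 8 * \<alpha>) powr (3 / 2)"
  proof -
    have "s = (1 + 8 * \<alpha>) powr (1 / 2)" using \<alpha> by (simp add: s_def powr_half_sqrt)
    then show ?thesis using \<alpha> by (simp only: powr_power) simp
  qed
  finally show ?thesis by (simp add: \<alpha>_def)
qed

end
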